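(* With $\Phi_\alpha$ ($\alpha\in(0,\infty)$) the distribution function defined in the context and $\Phi$ the standard normal distribution function, one has $$\sup_{x\in\mathbb R}|\Phi_\alpha(x)-\Phi(x)|=\frac{\sqrt\alpha}{\sqrt{2\pi}}(1+o(1))\quad\text{as }\alpha\to0^+,$$ and $$\sup_{x\in\mathbb R}\big|\Phi_\alpha(x)-e^{-e^{-x}}\big|=\frac{(\log\log\alpha)^2}{2e\log\alpha}(1+o(1))\quad\text{as }\alpha\to+\infty.$$
   Context: For $\alpha\in(0,\infty)$ put $$a=\sqrt{\log(\alpha+1)}-\frac{\log\big(\sqrt{2\pi}\log(\alpha+e^{1/\sqrt{2\pi}})\big)}{\sqrt{\log(\alpha+e)}},\qquad b=\frac1{\sqrt{\log(\alpha+e)}},$$ $$v_\alpha(j,x)=\frac{j}{\sqrt\alpha}+a+bx,\qquad \Phi_\alpha(x)=\prod_{j=0}^\infty\Phi(v_\alpha(j,x)),$$ where $\Phi$ is the standard normal distribution function. *)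

theory Defs
  imports "HOL-Probability.Probability" "HOL-Library.Landau_Symbols"
begin

definition std_normal_cdf :: "real \<Rightarrow> real" where
  "std_normal_cdf = cdf std_normal_distribution"

definition loc_a :: "real \<Rightarrow> real" where
  "loc_a \<alpha> = sqrt (ln (\<alpha> + 1))
     - ln (sqrt (2 * pi) * ln (\<alpha> + exp (1 / sqrt (2 * pi)))) / sqrt (ln (\<alpha> + exp 1))"

definition scale_b :: "real \<Rightarrow> real" where
  "scale_b \<alpha> = 1 / sqrt (ln (\<alpha> + exp 1))"

definition v :: "real \<Rightarrow> nat \<Rightarrow> real \<Rightarrow> real" where
  "v \<alpha> j x = real j / sqrt \<alpha> + loc_a \<alpha> + scale_b \<alpha> * x"

definition Phi_prod :: "real \<Rightarrow> real \<Rightarrow> real" where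
  "Phi_prod \<alpha> x = (\<Prod>j. std_normal_cdf (v \<alpha> j x))"

end

(*
  Taking logarithms turns Phi_alpha into exp of minus the sum of -ln Phi over an arithmetic progression
  of step h = 1 / sqrt alpha. Since -ln(1 - Q) is close to Q = 1 - Phi, and G(u) = phi(u) - u Q(u)
  satisfies G' = -Q, telescoping compares h times this sum with G(u).

  As alpha -> 0 the step tends to infinity and only the first factor Phi(a + b x) matters; a ~ sqrt alpha
  and 1 - b = O(alpha), so its distance to Phi is governed by the shift a, at most a / sqrt(2 pi), and
  this is attained asymptotically at x = 0.

  As alpha -> infinity, Mills ratio bounds give G(u) ~ phi(u) / u^2, and with M = ln(alpha + e) the sum
  equals exp(-x) exp(-(q - x)^2 / (2 M) + O(ln M / M)), where q = ln M + O(1), uniformly for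
  |x| <= ln M. Hence the difference to the Gumbel law is y exp(-y) (ln M)^2 / (2 M) to leading order with
  y = exp(-x), and y exp(-y) <= 1/e with equality at y = 1. Outside this range monotonicity
  in x suffices.
*)
theory Submission
  imports Defs "HOL-Real_Asymp.Real_Asymp"
begin

section \<open>The normal tail and Mills ratio bounds\<close>

abbreviation "\<phi> \<equiv> std_normal_density"

interpretation std_normal: real_distribution std_normal_distribution
  by (rule real_dist_normal_dist)

text \<open>Passes from the measure-theoretic distribution function to a gauge integral, so that the
  fundamental theorem of calculus applies. The measure charges a half-open interval, which differs
  from the closed one by a single point.\<close>

lemma std_normal_cdf_diff:
  assumes "a \<le> b"
  shows "std_normal_cdf b - std_normal_cdf a = integral {a..b} \<phi>"
proof (cases "a = b")
  case False
  with assms have ab: "a < b" by simp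
  then have negl: "{a..b} - {a<..b} = {a}" by auto
  have int: "set_integrable lborel {a<..b} \<phi>"
    unfolding set_integrable_def
    by (intro integrable_mult_indicator) auto
  have "std_normal_cdf b - std_normal_cdf a = measure std_normal_distribution {a<..b}"
    unfolding std_normal_cdf_def using std_normal.cdf_diff_eq[OF ab] .
  also have "\<dots> = (LINT x:{a<..b}|lborel. \<phi> x)"
  proof -
    have "emeasure std_normal_distribution {a<..b} = (\<integral>\<^sup>+x. ennreal (indicator {a<..b} x *\<^sub>R \<phi> x) \<partial>lborel)"
      by (subst emeasure_density) (auto intro!: nn_integral_cong split: split_indicator)
    then show ?thesis
      unfolding set_lebesgue_integral_def measure_def
      by (subst integral_eq_nn_integral) (auto simp: normal_density_nonneg)
  qed
  also have "\<dots> = integral {a<..b} \<phi>"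
    by (rule set_borel_integral_eq_integral(2)[OF int])
  also have "\<dots> = integral {a..b} \<phi>"
    by (rule integral_subset_negligible) (auto simp: negl)
  finally show ?thesis .
qed simp

lemma continuous_std_normal_density: "continuous_on A \<phi>"
  unfolding std_normal_density_def by (intro continuous_intros) auto

text \<open>The fundamental theorem needs a fixed base point. With base point \<open>x - 1\<close>
  the integral formula holds for all \<open>u > x - 1\<close>, hence on a neighbourhood of
  \<open>x\<close>, which is enough to transfer the derivative.\<close>

lemma std_normal_cdf_deriv: "(std_normal_cdf has_real_derivative \<phi> x) (at x)"
proof -
  have "((\<lambda>u. integral {x - 1..u} \<phi>) has_real_derivative \<phi> x) (at x within {x - 1..x + 1})"
    by (rule integral_has_real_derivative[OF continuous_std_normal_density]) auto
  then have "((\<lambda>u. integral {x - 1..u} \<phi>) has_real_derivative \<phi> x) (at x)"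
    by (simp add: at_within_Icc_at)
  then have "((\<lambda>u. std_normal_cdf (x - 1) + integral {x - 1..u} \<phi>) has_real_derivative \<phi> x) (at x)"
    by (auto intro!: derivative_eq_intros)
  moreover have "eventually (\<lambda>u. u \<in> {x - 1<..}) (nhds x)"
    by (rule eventually_nhds_in_open) auto
  then have "eventually (\<lambda>u. std_normal_cdf (x - 1) + integral {x - 1..u} \<phi> = std_normal_cdf u) (nhds x)"
    by eventually_elim (use std_normal_cdf_diff[of "x - 1"] in \<open>auto simp flip: std_normal_cdf_diff\<close>)
  ultimately show ?thesis
    by (subst (asm) DERIV_cong_ev[OF refl _ refl]) auto
qed

lemma DERIV_std_normal_cdf [derivative_intros]:
  assumes "(f has_real_derivative D) (at x within s)"
  shows "((\<lambda>x. std_normal_cdf (f x)) has_real_derivative \<phi> (f x) * D) (at x within s)"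
  using DERIV_chain2[OF std_normal_cdf_deriv assms] .

lemma DERIV_std_normal_density [derivative_intros]:
  assumes "(f has_real_derivative D) (at x within s)"
  shows "((\<lambda>x. \<phi> (f x)) has_real_derivative - f x * \<phi> (f x) * D) (at x within s)"
proof -
  have "(\<phi> has_real_derivative - y * \<phi> y) (at y)" for y
  proof -
    have "((\<lambda>y::real. - y\<^sup>2 / 2) has_real_derivative - y) (at y)"
      by (auto intro!: derivative_eq_intros)
    from DERIV_cmult[OF DERIV_chain2[OF DERIV_exp this], of "1 / sqrt (2 * pi)"]
    show ?thesis unfolding std_normal_density_def[abs_def] by (simp add: mult.commute)
  qed
  from DERIV_chain2[OF this assms] show ?thesis by simp
qed

lemma std_normal_density_at_top: "(\<phi> \<longlongrightarrow> 0) at_top"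
  unfolding std_normal_density_def by real_asymp

lemma std_normal_cdf_at_top: "(std_normal_cdf \<longlongrightarrow> 1) at_top"
  unfolding std_normal_cdf_def by (rule std_normal.cdf_lim_at_top_prob)

lemma std_normal_cdf_at_bot: "(std_normal_cdf \<longlongrightarrow> 0) at_bot"
  unfolding std_normal_cdf_def by (rule std_normal.cdf_lim_at_bot)

lemma std_normal_cdf_strict_mono: "x < y \<Longrightarrow> std_normal_cdf x < std_normal_cdf y"
  by (rule DERIV_pos_imp_increasing) (auto intro: std_normal_cdf_deriv exI[of _ "\<phi> _"] simp: normal_density_pos)

lemma std_normal_cdf_mono: "x \<le> y \<Longrightarrow> std_normal_cdf x \<le> std_normal_cdf y"
  using std_normal_cdf_strict_mono[of x y] by (cases "x = y") auto

lemma std_normal_cdf_pos: "0 < std_normal_cdf x"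
  using std_normal_cdf_strict_mono[of "x - 1" x] std_normal.cdf_nonneg[of "x - 1"]
  by (simp add: std_normal_cdf_def)

lemma std_normal_cdf_less_1: "std_normal_cdf x < 1"
  using std_normal_cdf_strict_mono[of x "x + 1"] std_normal.cdf_bounded_prob[of "x + 1"]
  by (simp add: std_normal_cdf_def)

lemma std_normal_cdf_diff_bound:
  assumes "x \<le> y" "\<And>t. x \<le> t \<Longrightarrow> t \<le> y \<Longrightarrow> \<phi> t \<le> B"
  shows "std_normal_cdf y - std_normal_cdf x \<le> B * (y - x)"
proof (cases "x = y")
  case False
  with assms(1) have "x < y" by simp
  from MVT2[OF this std_normal_cdf_deriv] obtain z where
    z: "x < z" "z < y" "std_normal_cdf y - std_normal_cdf x = (y - x) * \<phi> z" by blast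
  have "(y - x) * \<phi> z \<le> (y - x) * B"
    using z assms by (intro mult_left_mono) auto
  with z show ?thesis by (simp add: mult.commute)
qed simp

lemma std_normal_density_le_0: "\<phi> x \<le> 1 / sqrt (2 * pi)"
  unfolding std_normal_density_def by (simp add: divide_simps)

text \<open>A nonincreasing function lies above its limit at infinity. Each Mills bound follows by
  applying this to the difference of its two sides, whose derivative is explicit.\<close>

lemma nonneg_if_decreasing_to_0:
  fixes f :: "real \<Rightarrow> real"
  assumes "\<And>t. x \<le> t \<Longrightarrow> (f has_real_derivative f' t) (at t)"
    and "\<And>t. x \<le> t \<Longrightarrow> f' t \<le> 0" and "(f \<longlongrightarrow> 0) at_top"
  shows "0 \<le> f x"
proof (rule tendsto_upperbound[OF assms(3)])
  show "eventually (\<lambda>y. f y \<le> f x) at_top"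
    using eventually_ge_at_top[of x]
  proof eventually_elim
    case (elim y)
    show ?case
    proof (rule DERIV_nonpos_imp_nonincreasing[OF elim])
      fix t assume "x \<le> t"
      from assms(1,2)[OF this] show "\<exists>d. (f has_real_derivative d) (at t) \<and> d \<le> 0"
        by (intro exI conjI)
    qed
  qed
qed simp

section \<open>The upper tail and its asymptotic expansion\<close>

definition Q :: "real \<Rightarrow> real" where "Q x = 1 - std_normal_cdf x"

lemma Q_pos: "0 < Q x" and Q_less_1: "Q x < 1"
  using std_normal_cdf_less_1[of x] std_normal_cdf_pos[of x] by (auto simp: Q_def)

lemma Q_antimono: "x \<le> y \<Longrightarrow> Q y \<le> Q x"
  using std_normal_cdf_mono[of x y] by (simp add: Q_def)

lemma Q_at_top: "(Q \<longlongrightarrow> 0) at_top"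
  unfolding Q_def[abs_def]
  by (rule tendsto_eq_rhs[OF tendsto_diff[OF tendsto_const std_normal_cdf_at_top]]) simp

lemma DERIV_Q [derivative_intros]:
  assumes "(f has_real_derivative D) (at x within s)"
  shows "((\<lambda>x. Q (f x)) has_real_derivative - \<phi> (f x) * D) (at x within s)"
  unfolding Q_def
  by (rule DERIV_cong[OF DERIV_diff[OF DERIV_const DERIV_std_normal_cdf[OF assms]]]) simp

text \<open>Since the density has derivative \<open>- t * \<phi> t\<close>, the derivatives of
  consecutive terms of the Mills expansion cancel in pairs. The exponents \<open>k\<close> and
  \<open>m\<close> are tied to \<open>n\<close> by premises so that the rule unifies with numeral
  exponents.\<close>

lemma DERIV_density_over_power:
  assumes "t \<noteq> 0" and k: "k = n + 1" and m: "m = n + 2"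
  shows "((\<lambda>t. \<phi> t / t ^ k) has_real_derivative
           (- (\<phi> t / t ^ n) - real k * (\<phi> t / t ^ m))) (at t)"
proof -
  have "((\<lambda>t. \<phi> t / t ^ Suc n) has_real_derivative
      ((- t * \<phi> t * 1) * t ^ Suc n - \<phi> t * (real (Suc n) * t ^ n)) / (t ^ Suc n * t ^ Suc n)) (at t)"
    using DERIV_divide[OF DERIV_std_normal_density[OF DERIV_ident] DERIV_pow[of "Suc n" t]] assms
    by simp
  also have "((- t * \<phi> t * 1) * t ^ Suc n - \<phi> t * (real (Suc n) * t ^ n)) / (t ^ Suc n * t ^ Suc n)
      = - (\<phi> t / t ^ n) - real (Suc n) * (\<phi> t / t ^ (n + 2))"
  proof -
    have "((- t * f * 1) * (t * p) - f * (c * p)) / ((t * p) * (t * p)) = - (f / p) - c * (f / (p * (t * t)))"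
      if "p \<noteq> 0" for f c p :: real
      using that assms(1) by (simp add: divide_simps) (simp add: algebra_simps power2_eq_square)
    from this[of "t ^ n"] show ?thesis
      using assms(1) by (simp add: power_add)
  qed
  finally show ?thesis by (simp add: k m)
qed

lemma density_over_power_at_top: "((\<lambda>t. \<phi> t / t ^ n) \<longlongrightarrow> 0) at_top"
proof (rule tendsto_sandwich[OF _ _ tendsto_const std_normal_density_at_top])
  show "eventually (\<lambda>t. 0 \<le> \<phi> t / t ^ n) at_top"
    using eventually_ge_at_top[of 1]
    by eventually_elim (simp add: normal_density_nonneg)
  show "eventually (\<lambda>t. \<phi> t / t ^ n \<le> \<phi> t) at_top"
    using eventually_ge_at_top[of 1]
  proof eventually_elim
    case (elim t)
    then have "\<phi> t / t ^ n \<le> \<phi> t / 1"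
      by (intro divide_left_mono) (auto simp: normal_density_nonneg)
    then show ?case by simp
  qed
qed

text \<open>Two terms of the expansion of \<open>Q\<close>. All terms of the derivative of the
  difference cancel except the last, \<open>- 3 * \<phi> t / t ^ 4\<close>, whose sign decides the
  inequality.\<close>

lemma Mills_lower:
  assumes "0 < x"
  shows "\<phi> x / x - \<phi> x / x ^ 3 \<le> Q x"
proof -
  define f where "f t = Q t - \<phi> t / t ^ 1 + \<phi> t / t ^ 3" for t
  have "0 \<le> f x"
  proof (rule nonneg_if_decreasing_to_0[where f = f and x = x])
    fix t assume "x \<le> t"
    with assms have t: "t \<noteq> 0" by simp
    have "(f has_real_derivative - \<phi> t * 1 - (- (\<phi> t / t ^ 0) - real 1 * (\<phi> t / t ^ 2))
        + (- (\<phi> t / t ^ 2) - real 3 * (\<phi> t / t ^ 4))) (at t)"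
      unfolding f_def
      by (intro DERIV_add DERIV_diff DERIV_Q DERIV_ident DERIV_density_over_power t) simp_all
    then show "(f has_real_derivative - (3 * (\<phi> t / t ^ 4))) (at t)" by simp
    show "- (3 * (\<phi> t / t ^ 4)) \<le> 0" by simp
  next
    have "(f \<longlongrightarrow> 0 - 0 + 0) at_top"
      unfolding f_def by (intro tendsto_add tendsto_diff Q_at_top density_over_power_at_top)
    then show "(f \<longlongrightarrow> 0) at_top" by simp
  qed
  then show ?thesis by (simp add: f_def)
qed

text \<open>One further term of the expansion reverses the inequality; the surviving derivative is
  \<open>- 15 * \<phi> t / t ^ 6\<close>.\<close>

lemma Mills_upper:
  assumes "0 < x"
  shows "Q x \<le> \<phi> x / x - \<phi> x / x ^ 3 + 3 * (\<phi> x / x ^ 5)"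
proof -
  define f where "f t = \<phi> t / t ^ 1 - \<phi> t / t ^ 3 + 3 * (\<phi> t / t ^ 5) - Q t" for t
  have "0 \<le> f x"
  proof (rule nonneg_if_decreasing_to_0[where f = f and x = x])
    fix t assume "x \<le> t"
    with assms have t: "t \<noteq> 0" by simp
    have "(f has_real_derivative - (\<phi> t / t ^ 0) - real 1 * (\<phi> t / t ^ 2)
        - (- (\<phi> t / t ^ 2) - real 3 * (\<phi> t / t ^ 4))
        + 3 * (- (\<phi> t / t ^ 4) - real 5 * (\<phi> t / t ^ 6)) - (- \<phi> t * 1)) (at t)"
      unfolding f_def
      by (intro DERIV_add DERIV_diff DERIV_cmult DERIV_Q DERIV_ident DERIV_density_over_power t) simp_all
    then show "(f has_real_derivative - (15 * (\<phi> t / t ^ 6))) (at t)"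
      by (rule DERIV_cong) simp
    show "- (15 * (\<phi> t / t ^ 6)) \<le> 0" by simp
  next
    have "(f \<longlongrightarrow> 0 - 0 + 3 * 0 - 0) at_top"
      unfolding f_def
      by (intro tendsto_add tendsto_diff tendsto_mult_left Q_at_top density_over_power_at_top)
    then show "(f \<longlongrightarrow> 0) at_top" by simp
  qed
  then show ?thesis by (simp add: f_def)
qed

lemma Mills_simple:
  assumes "0 < x"
  shows "Q x \<le> \<phi> x / x"
proof -
  define f where "f t = \<phi> t / t ^ 1 - Q t" for t
  have "0 \<le> f x"
  proof (rule nonneg_if_decreasing_to_0[where f = f and x = x])
    fix t assume "x \<le> t"
    with assms have t: "t \<noteq> 0" by simp
    have "(f has_real_derivative - (\<phi> t / t ^ 0) - real 1 * (\<phi> t / t ^ 2) - (- \<phi> t * 1)) (at t)"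
      unfolding f_def
      by (intro DERIV_diff DERIV_Q DERIV_ident DERIV_density_over_power t) simp_all
    then show "(f has_real_derivative - (\<phi> t / t\<^sup>2)) (at t)" by simp
    show "- (\<phi> t / t\<^sup>2) \<le> 0" by simp
  next
    have "(f \<longlongrightarrow> 0 - 0) at_top"
      unfolding f_def by (intro tendsto_diff Q_at_top density_over_power_at_top)
    then show "(f \<longlongrightarrow> 0) at_top" by simp
  qed
  then show ?thesis by (simp add: f_def)
qed

text \<open>The density is even, so both sides have the same derivative and differ by a constant;
  the limit at infinity shows that this constant is 0.\<close>

lemma Q_minus: "Q (- x) = std_normal_cdf x"
proof -
  define f where "f t = std_normal_cdf t - Q (- t)" for t
  have "(f has_real_derivative 0) (at t)" for t
    unfolding f_def by (auto intro!: derivative_eq_intros simp: std_normal_density_def)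
  then have "\<forall>y. (f has_real_derivative 0) (at y)" by blast
  then have "f y = f x" for y by (rule DERIV_isconst_all)
  then have "(f \<longlongrightarrow> f x) at_top"
    by (intro tendsto_eventually always_eventually allI)
  moreover have "(f \<longlongrightarrow> 1 - 1) at_top"
    unfolding f_def
  proof (intro tendsto_diff std_normal_cdf_at_top)
    have "((\<lambda>t. std_normal_cdf (- t)) \<longlongrightarrow> 0) at_top"
      by (rule filterlim_compose[OF std_normal_cdf_at_bot filterlim_uminus_at_bot_at_top])
    then show "((\<lambda>t. Q (- t)) \<longlongrightarrow> 1) at_top"
      unfolding Q_def by (auto intro!: tendsto_eq_intros)
  qed
  ultimately have "f x = 1 - 1"
    by (rule tendsto_unique[OF trivial_limit_at_top_linorder])
  then show ?thesis by (simp add: f_def)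
qed

text \<open>\<open>G\<close> is the iterated tail, the integral of \<open>Q\<close> over the half-line from \<open>x\<close>.\<close>

definition G :: "real \<Rightarrow> real" where "G x = \<phi> x - x * Q x"

lemma DERIV_G: "(G has_real_derivative - Q x) (at x)"
  unfolding G_def by (auto intro!: derivative_eq_intros)

text \<open>After multiplication of the Mills bounds by \<open>x\<close> the leading term cancels
  against \<phi> in \<open>G\<close>. The order of \<open>G\<close> is therefore set by the second
  term of the expansion, and its relative error by the third.\<close>

lemma G_bounds:
  assumes "0 < x"
  shows "G x \<le> \<phi> x / x\<^sup>2" "\<phi> x / x\<^sup>2 * (1 - 3 / x\<^sup>2) \<le> G x"
proof -
  have "x * (\<phi> x / x - \<phi> x / x ^ 3) \<le> x * Q x"
    using assms by (intro mult_left_mono Mills_lower) auto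
  moreover have "x * (\<phi> x / x - \<phi> x / x ^ 3) = \<phi> x - \<phi> x / x\<^sup>2"
    using assms by (simp add: divide_simps) algebra
  ultimately show "G x \<le> \<phi> x / x\<^sup>2"
    by (simp add: G_def)
  have "x * Q x \<le> x * (\<phi> x / x - \<phi> x / x ^ 3 + 3 * (\<phi> x / x ^ 5))"
    using assms by (intro mult_left_mono Mills_upper) auto
  moreover have "x * (\<phi> x / x - \<phi> x / x ^ 3 + 3 * (\<phi> x / x ^ 5)) = \<phi> x - \<phi> x / x\<^sup>2 * (1 - 3 / x\<^sup>2)"
    using assms by (simp add: divide_simps) algebra
  ultimately show "\<phi> x / x\<^sup>2 * (1 - 3 / x\<^sup>2) \<le> G x"
    by (simp add: G_def)
qed

lemma G_at_top: "(G \<longlongrightarrow> 0) at_top"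
proof (rule tendsto_sandwich[of "\<lambda>_. 0" G at_top \<phi>])
  show "eventually (\<lambda>x. 0 \<le> G x) at_top"
    using eventually_gt_at_top[of 0]
  proof eventually_elim
    case (elim x)
    have "x * Q x \<le> x * (\<phi> x / x)"
      using elim by (intro mult_left_mono Mills_simple) auto
    with elim show ?case by (simp add: G_def)
  qed
  show "eventually (\<lambda>x. G x \<le> \<phi> x) at_top"
    using eventually_gt_at_top[of 0]
    by eventually_elim (simp add: G_def Q_pos less_imp_le)
qed (auto intro: std_normal_density_at_top)

section \<open>Sums of the tail over an arithmetic progression\<close>

lemma G_step:
  assumes "0 < h"
  shows "h * Q (x + h) \<le> G x - G (x + h)" "G x - G (x + h) \<le> h * Q x"
proof -
  have "x < x + h" using assms by simp
  from MVT2[OF this DERIV_G] obtain z where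
    z: "x < z" "z < x + h" "G (x + h) - G x = h * - Q z" by auto
  moreover have "h * Q (x + h) \<le> h * Q z" "h * Q z \<le> h * Q x"
    using z assms by (auto intro!: mult_left_mono Q_antimono)
  ultimately show "h * Q (x + h) \<le> G x - G (x + h)" "G x - G (x + h) \<le> h * Q x"
    by linarith+
qed

text \<open>The increments of \<open>G\<close> along the progression telescope to
  \<open>G x\<close>, and each increment lies between \<open>h\<close> times the values of
  \<open>Q\<close> at the two ends of its interval. The right ends give the sum that starts at index
  1; its domination by the telescoping series also gives summability.\<close>

lemma
  assumes "0 < h"
  shows summable_Q: "summable (\<lambda>j. Q (x + real j * h))"
    and suminf_Q_lower: "G x \<le> h * (\<Sum>j. Q (x + real j * h))"
    and suminf_Q_upper: "h * (\<Sum>j. Q (x + real (Suc j) * h)) \<le> G x"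
proof -
  have "filterlim (\<lambda>j. x + real j * h) at_top sequentially"
    using assms by real_asymp
  then have lim: "(\<lambda>j. G (x + real j * h)) \<longlonglongrightarrow> 0"
    by (rule filterlim_compose[OF G_at_top])
  have tele: "(\<lambda>j. G (x + real j * h) - G (x + real (Suc j) * h)) sums G x"
    using telescope_sums'[OF lim] by simp
  have eq: "x + real (Suc j) * h = x + real j * h + h" for j
    by (simp add: algebra_simps)
  have le: "h * Q (x + real (Suc j) * h) \<le> G (x + real j * h) - G (x + real (Suc j) * h)"
    and ge: "G (x + real j * h) - G (x + real (Suc j) * h) \<le> h * Q (x + real j * h)" for j
    unfolding eq using G_step[OF assms] by blast+
  have s1: "summable (\<lambda>j. h * Q (x + real (Suc j) * h))"
  proof (rule summable_comparison_test'[OF sums_summable[OF tele], of 0])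
    fix j :: nat
    have "0 \<le> h * Q (x + real (Suc j) * h)"
      using assms Q_pos by (simp add: less_imp_le)
    with le[of j] show "norm (h * Q (x + real (Suc j) * h)) \<le> G (x + real j * h) - G (x + real (Suc j) * h)"
      by simp
  qed
  then have s2: "summable (\<lambda>j. Q (x + real (Suc j) * h))"
    using assms by (simp add: summable_cmult_iff)
  then show s3: "summable (\<lambda>j. Q (x + real j * h))"
    using summable_Suc_iff[of "\<lambda>j. Q (x + real j * h)"] by blast
  have "G x \<le> (\<Sum>j. h * Q (x + real j * h))"
    using suminf_le[OF ge sums_summable[OF tele] summable_mult[OF s3]] sums_unique[OF tele] by simp
  then show "G x \<le> h * (\<Sum>j. Q (x + real j * h))"
    using s3 by (simp add: suminf_mult)
  have "(\<Sum>j. h * Q (x + real (Suc j) * h)) \<le> G x"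
    using suminf_le[OF le s1 sums_summable[OF tele]] sums_unique[OF tele] by simp
  then show "h * (\<Sum>j. Q (x + real (Suc j) * h)) \<le> G x"
    using suminf_mult[OF s2, of h] by simp
qed

section \<open>The logarithm of the infinite product\<close>

definition neg_log_tail :: "real \<Rightarrow> real \<Rightarrow> real" where
  "neg_log_tail u h = (\<Sum>j. - ln (std_normal_cdf (u + real j * h)))"

lemma neg_ln_cdf_ge: "Q x \<le> - ln (std_normal_cdf x)"
  using ln_le_minus_one[OF std_normal_cdf_pos[of x]] by (simp add: Q_def)

lemma neg_ln_cdf_nonneg: "0 \<le> - ln (std_normal_cdf x)"
  using neg_ln_cdf_ge[of x] Q_pos[of x] by simp

text \<open>From \<open>- ln (1 - p) \<le> p + 2 * p * p\<close> for \<open>p \<le> 1 / 2\<close>.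
  Bounding one of the two factors \<open>Q x\<close> by \<open>Q u\<close> makes the constant
  uniform along a progression that starts at \<open>u\<close>.\<close>

lemma neg_ln_cdf_le:
  assumes "u \<le> x" "Q u \<le> 1 / 2"
  shows "- ln (std_normal_cdf x) \<le> (1 + 2 * Q u) * Q x"
proof -
  have le: "Q x \<le> Q u" using assms by (intro Q_antimono)
  have "- Q x - 2 * (Q x)\<^sup>2 \<le> ln (1 - Q x)"
    using le assms Q_pos[of x] by (intro ln_one_minus_pos_lower_bound) auto
  moreover have "Q x * Q x \<le> Q u * Q x"
    using le Q_pos[of x] by (intro mult_right_mono) auto
  moreover have "ln (1 - Q x) = ln (std_normal_cdf x)" by (simp add: Q_def)
  moreover have "(1 + 2 * Q u) * Q x = Q x + 2 * (Q u * Q x)" by (simp add: algebra_simps)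
  ultimately show ?thesis unfolding power2_eq_square by linarith
qed

lemma summable_neg_ln_cdf:
  assumes "0 < h"
  shows "summable (\<lambda>j. - ln (std_normal_cdf (u + real j * h)))"
proof (rule summable_comparison_test_ev)
  have "filterlim (\<lambda>j. u + real j * h) at_top sequentially"
    using assms by real_asymp
  from filterlim_compose[OF Q_at_top this]
  have "eventually (\<lambda>j. Q (u + real j * h) < 1 / 2) sequentially"
    by (rule order_tendstoD) simp
  then show "eventually (\<lambda>j. norm (- ln (std_normal_cdf (u + real j * h))) \<le> 2 * Q (u + real j * h)) sequentially"
  proof eventually_elim
    case (elim j)
    let ?x = "u + real j * h"
    have "- ln (std_normal_cdf ?x) \<le> (1 + 2 * Q ?x) * Q ?x"
      using elim by (intro neg_ln_cdf_le) auto
    also have "\<dots> \<le> 2 * Q ?x"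
      using elim Q_pos[of ?x] by (intro mult_right_mono) auto
    finally show ?case using neg_ln_cdf_nonneg[of ?x] by simp
  qed
  show "summable (\<lambda>j. 2 * Q (u + real j * h))"
    using summable_Q[OF assms] by (rule summable_mult)
qed

lemma neg_log_tail_nonneg: "0 < h \<Longrightarrow> 0 \<le> neg_log_tail u h"
  unfolding neg_log_tail_def by (intro suminf_nonneg summable_neg_ln_cdf neg_ln_cdf_nonneg)

lemma neg_log_tail_antimono:
  assumes "0 < h" "u \<le> w"
  shows "neg_log_tail w h \<le> neg_log_tail u h"
  unfolding neg_log_tail_def
proof (intro suminf_le summable_neg_ln_cdf assms(1))
  fix j
  show "- ln (std_normal_cdf (w + real j * h)) \<le> - ln (std_normal_cdf (u + real j * h))"
    using std_normal_cdf_mono[of "u + real j * h" "w + real j * h"] assms std_normal_cdf_pos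
    by simp
qed

lemma neg_log_tail_ge:
  assumes "0 < h"
  shows "G u / h \<le> neg_log_tail u h"
proof -
  have "(\<Sum>j. Q (u + real j * h)) \<le> neg_log_tail u h"
    unfolding neg_log_tail_def
    by (intro suminf_le neg_ln_cdf_ge summable_Q summable_neg_ln_cdf assms)
  then have "h * (\<Sum>j. Q (u + real j * h)) \<le> h * neg_log_tail u h"
    using assms by (intro mult_left_mono) auto
  with suminf_Q_lower[OF assms, of u] have "G u \<le> h * neg_log_tail u h" by linarith
  then show ?thesis using assms by (simp add: divide_simps mult.commute)
qed

text \<open>The factor \<open>1 + 2 * Q u\<close> is the cost of replacing the logarithm by
  \<open>Q\<close>; the summand \<open>Q u\<close> is the term of index 0, which the Riemann sum
  over right ends omits.\<close>

lemma neg_log_tail_le: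
  assumes "0 < h" "Q u \<le> 1 / 2"
  shows "neg_log_tail u h \<le> (1 + 2 * Q u) * (G u / h + Q u)"
proof -
  have s: "summable (\<lambda>j. Q (u + real j * h))" by (rule summable_Q[OF assms(1)])
  have "neg_log_tail u h \<le> (\<Sum>j. (1 + 2 * Q u) * Q (u + real j * h))"
    unfolding neg_log_tail_def using assms
    by (intro suminf_le neg_ln_cdf_le summable_mult s summable_neg_ln_cdf) auto
  also have "\<dots> = (1 + 2 * Q u) * (\<Sum>j. Q (u + real j * h))"
    using s by (rule suminf_mult)
  also have "(\<Sum>j. Q (u + real j * h)) = (\<Sum>j. Q (u + real (Suc j) * h)) + Q u"
    using suminf_split_head[OF s] by simp
  also have "(\<Sum>j. Q (u + real (Suc j) * h)) \<le> G u / h"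
    using suminf_Q_upper[OF assms(1), of u] assms(1) by (simp add: divide_simps mult.commute)
  finally show ?thesis using Q_pos[of u] by (simp add: mult_left_mono)
qed

lemma neg_log_tail_split_head:
  assumes "0 < h"
  shows "neg_log_tail u h = neg_log_tail (u + h) h - ln (std_normal_cdf u)"
proof -
  have eq: "u + real (Suc j) * h = u + h + real j * h" for j
    by (simp add: algebra_simps)
  show ?thesis
    using suminf_split_head[OF summable_neg_ln_cdf[OF assms, of u]]
    unfolding neg_log_tail_def eq by simp
qed

section \<open>The product as an exponential, and bounds for suprema\<close>

lemma Phi_prod_eq:
  assumes "0 < \<alpha>"
  shows "Phi_prod \<alpha> x = exp (- neg_log_tail (loc_a \<alpha> + scale_b \<alpha> * x) (1 / sqrt \<alpha>))"
proof -
  let ?u = "loc_a \<alpha> + scale_b \<alpha> * x" and ?h = "1 / sqrt \<alpha>"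
  have h: "?h > 0" using assms by simp
  have "v \<alpha> j x = ?u + real j * ?h" for j by (simp add: v_def)
  then have "Phi_prod \<alpha> x = (\<Prod>j. exp (ln (std_normal_cdf (?u + real j * ?h))))"
    unfolding Phi_prod_def by (simp add: std_normal_cdf_pos)
  also have "\<dots> = exp (\<Sum>j. ln (std_normal_cdf (?u + real j * ?h)))"
    using summable_minus[OF summable_neg_ln_cdf[OF h, of ?u]] by (intro prodinf_exp) simp
  also have "(\<Sum>j. ln (std_normal_cdf (?u + real j * ?h))) = - neg_log_tail ?u ?h"
    using suminf_minus[OF summable_neg_ln_cdf[OF h, of ?u]] unfolding neg_log_tail_def by simp
  finally show ?thesis .
qed

lemma scale_b_bounds: "0 < \<alpha> \<Longrightarrow> 0 < scale_b \<alpha>" "0 < \<alpha> \<Longrightarrow> scale_b \<alpha> \<le> 1"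
proof -
  assume "0 < \<alpha>"
  then have "1 < ln (\<alpha> + exp 1)"
    by (subst ln_exp[of 1, symmetric], subst ln_less_cancel_iff) (auto simp: add_pos_pos)
  then show "0 < scale_b \<alpha>" "scale_b \<alpha> \<le> 1" by (auto simp: scale_b_def)
qed

text \<open>The uniform bound \<open>U\<close> also shows that the range is bounded above, without
  which a real supremum says nothing about the values.\<close>

lemma sup_abs_bounds:
  fixes f :: "real \<Rightarrow> real"
  assumes "\<And>x. \<bar>f x\<bar> \<le> U" "L \<le> \<bar>f y\<bar>"
  shows "(SUP x. \<bar>f x\<bar>) \<in> {L..U}"
proof -
  have "bdd_above (range (\<lambda>x. \<bar>f x\<bar>))"
    using assms(1) by (intro bdd_aboveI2)
  then have "\<bar>f y\<bar> \<le> (SUP x. \<bar>f x\<bar>)" by (intro cSUP_upper) auto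
  moreover have "(SUP x. \<bar>f x\<bar>) \<le> U" using assms(1) by (intro cSUP_least) auto
  ultimately show ?thesis using assms(2) by auto
qed

section \<open>The normal limit\<close>

lemma std_normal_density_antimono: "0 \<le> x \<Longrightarrow> x \<le> y \<Longrightarrow> \<phi> y \<le> \<phi> x"
  unfolding std_normal_density_def by (auto intro!: mult_left_mono power_mono divide_right_mono)

text \<open>Combines \<open>t \<le> 1 + t\<^sup>2 / 2 \<le> exp (t\<^sup>2 / 2)\<close> with
  \<open>\<phi> t \<le> exp (- t\<^sup>2 / 2)\<close>.\<close>

lemma mult_std_normal_density_le_1: "t * \<phi> t \<le> 1"
proof -
  have "1 * exp (- t\<^sup>2 / 2) \<le> sqrt (2 * pi) * exp (- t\<^sup>2 / 2)"
    using pi_gt3 by (intro mult_right_mono) auto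
  then have le1: "\<phi> t \<le> exp (- t\<^sup>2 / 2)"
    unfolding std_normal_density_def by (simp add: divide_simps mult.commute)
  have le2: "t \<le> exp (t\<^sup>2 / 2)"
  proof -
    have "0 \<le> (t - 1)\<^sup>2" by simp
    then have "t \<le> 1 + t\<^sup>2 / 2" by (simp add: power2_eq_square algebra_simps)
    also have "\<dots> \<le> exp (t\<^sup>2 / 2)" by (rule exp_ge_add_one_self)
    finally show ?thesis .
  qed
  have "t * \<phi> t \<le> exp (t\<^sup>2 / 2) * exp (- t\<^sup>2 / 2)"
  proof (cases "0 \<le> t")
    case True
    then show ?thesis using le1 le2 by (intro mult_mono) auto
  next
    case False
    then have "t * \<phi> t \<le> 0" by (intro mult_nonpos_nonneg) auto
    also have "0 \<le> exp (t\<^sup>2 / 2) * exp (- t\<^sup>2 / 2)" by simp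
    finally show ?thesis .
  qed
  also have "\<dots> = 1" by (simp flip: exp_add)
  finally show ?thesis .
qed

lemma cdf_shift_upper: "0 \<le> s \<Longrightarrow> std_normal_cdf (x + s) - std_normal_cdf x \<le> s / sqrt (2 * pi)"
  using std_normal_cdf_diff_bound[of x "x + s" "1 / sqrt (2 * pi)"] std_normal_density_le_0 by simp

lemma cdf_shift_lower:
  assumes "0 \<le> s"
  shows "s * \<phi> s \<le> std_normal_cdf s - std_normal_cdf 0"
proof (cases "s = 0")
  case False
  with assms have "0 < s" by simp
  from MVT2[OF this std_normal_cdf_deriv] obtain z where
    z: "0 < z" "z < s" "std_normal_cdf s - std_normal_cdf 0 = (s - 0) * \<phi> z" by blast
  have "s * \<phi> s \<le> s * \<phi> z"
    using z by (intro mult_left_mono std_normal_density_antimono) auto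
  with z show ?thesis by simp
qed simp

text \<open>For \<open>x \<ge> 0\<close> the density on the interval from \<open>b * x\<close> to
  \<open>x\<close> is at most its value at \<open>b * x\<close>. The length of the interval is
  \<open>b * x\<close> times \<open>(1 - b) / b\<close>, and the factor \<open>b * x\<close> is
  absorbed by the density, so the bound is uniform in \<open>x\<close>. Negative \<open>x\<close>
  follow by symmetry.\<close>

lemma cdf_scale:
  assumes "0 < b" "b \<le> 1"
  shows "\<bar>std_normal_cdf (b * x) - std_normal_cdf x\<bar> \<le> (1 - b) / b"
proof -
  have *: "\<bar>std_normal_cdf (b * x) - std_normal_cdf x\<bar> \<le> (1 - b) / b" if "0 \<le> x" for x
  proof -
    have le: "b * x \<le> x" using assms that by (simp add: mult_left_le_one_le)
    have "std_normal_cdf x - std_normal_cdf (b * x) \<le> \<phi> (b * x) * (x - b * x)"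
      using assms that le by (intro std_normal_cdf_diff_bound std_normal_density_antimono) auto
    also have "\<dots> = (b * x * \<phi> (b * x)) * ((1 - b) / b)"
      using assms by (simp add: field_simps)
    also have "\<dots> \<le> 1 * ((1 - b) / b)"
      using assms by (intro mult_right_mono mult_std_normal_density_le_1) auto
    finally show ?thesis using std_normal_cdf_mono[OF le] by simp
  qed
  show ?thesis
  proof (cases "0 \<le> x")
    case False
    then show ?thesis using *[of "- x"] Q_minus[of x] Q_minus[of "b * x"] by (simp add: Q_def)
  qed (rule *)
qed

lemma Q_le_half: "0 \<le> x \<Longrightarrow> Q x \<le> 1 / 2"
  using Q_minus[of 0] Q_antimono[of 0 x] by (simp add: Q_def)

text \<open>Controls all factors of the product except the first.\<close>

definition remainder_bound :: "real \<Rightarrow> real" where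
  "remainder_bound h = 2 * (\<phi> (h / 2) / (h / 2)\<^sup>2 / h + \<phi> (h / 2) / (h / 2))"

text \<open>The hypothesis puts all arguments after the first at or beyond \<open>h / 2\<close>,
  where the tail is Gaussian small for large \<open>h\<close>.\<close>

lemma neg_log_tail_remainder:
  assumes "0 < h" "- h / 2 \<le> u"
  shows "neg_log_tail (u + h) h \<le> remainder_bound h"
proof -
  have h2: "0 < h / 2" using assms by simp
  have "neg_log_tail (u + h) h \<le> neg_log_tail (h / 2) h"
    using assms by (intro neg_log_tail_antimono) auto
  also have "\<dots> \<le> (1 + 2 * Q (h / 2)) * (G (h / 2) / h + Q (h / 2))"
    using assms by (intro neg_log_tail_le Q_le_half) auto
  also have "\<dots> \<le> 2 * (\<phi> (h / 2) / (h / 2)\<^sup>2 / h + \<phi> (h / 2) / (h / 2))"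
  proof (rule mult_mono)
    show "1 + 2 * Q (h / 2) \<le> 2" using Q_le_half[of "h / 2"] h2 by simp
    show le: "G (h / 2) / h + Q (h / 2) \<le> \<phi> (h / 2) / (h / 2)\<^sup>2 / h + \<phi> (h / 2) / (h / 2)"
      using assms h2 by (intro add_mono divide_right_mono G_bounds Mills_simple) auto
    have "0 \<le> (1 + 2 * Q (h / 2)) * (G (h / 2) / h + Q (h / 2))"
      using neg_log_tail_le[OF assms(1) Q_le_half[of "h / 2"]] neg_log_tail_nonneg[OF assms(1), of "h / 2"] h2
      by simp
    then show "0 \<le> G (h / 2) / h + Q (h / 2)"
      using Q_pos[of "h / 2"] by (simp add: zero_le_mult_iff)
  qed simp
  finally show ?thesis by (simp only: remainder_bound_def)
qed

text \<open>The product is its first factor times \<open>exp (- N)\<close>, where \<open>N\<close>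
  collects the later factors and satisfies \<open>0 \<le> N \<le> remainder_bound h\<close> in the
  stated range.\<close>

lemma Phi_prod_head:
  assumes "0 < \<alpha>"
  shows "Phi_prod \<alpha> x \<le> std_normal_cdf (loc_a \<alpha> + scale_b \<alpha> * x)" (is "_ \<le> std_normal_cdf ?u")
    and "- (1 / sqrt \<alpha>) / 2 \<le> loc_a \<alpha> + scale_b \<alpha> * x \<Longrightarrow>
      std_normal_cdf (loc_a \<alpha> + scale_b \<alpha> * x) - remainder_bound (1 / sqrt \<alpha>) \<le> Phi_prod \<alpha> x"
proof -
  let ?h = "1 / sqrt \<alpha>"
  let ?N = "neg_log_tail (?u + ?h) ?h"
  have h: "0 < ?h" using assms by simp
  have eq: "Phi_prod \<alpha> x = std_normal_cdf ?u * exp (- ?N)"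
    unfolding Phi_prod_eq[OF assms] neg_log_tail_split_head[OF h, of ?u]
    by (simp add: exp_diff exp_minus std_normal_cdf_pos divide_inverse)
  have N: "0 \<le> ?N" by (rule neg_log_tail_nonneg[OF h])
  show "Phi_prod \<alpha> x \<le> std_normal_cdf ?u"
    unfolding eq using N std_normal_cdf_pos[of ?u] by (intro mult_right_le_one_le) auto
  assume "- ?h / 2 \<le> ?u"
  then have "?N \<le> remainder_bound ?h" by (rule neg_log_tail_remainder[OF h])
  moreover have "std_normal_cdf ?u * (1 - ?N) \<le> std_normal_cdf ?u * exp (- ?N)"
    using std_normal_cdf_pos[of ?u] exp_ge_add_one_self[of "- ?N"] by (intro mult_left_mono) auto
  moreover have "std_normal_cdf ?u * ?N \<le> 1 * ?N"
    using N std_normal_cdf_less_1[of ?u] by (intro mult_right_mono) auto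
  ultimately show "std_normal_cdf ?u - remainder_bound ?h \<le> Phi_prod \<alpha> x"
    unfolding eq by (simp add: right_diff_distrib)
qed

text \<open>Three errors occur: the shift by \<open>loc_a\<close>, the rescaling by
  \<open>scale_b\<close>, and the later factors. The lower bound comes from \<open>x = 0\<close>,
  where the rescaling has no effect.\<close>

lemma small_alpha_bounds:
  fixes \<alpha> :: real
  defines "h \<equiv> 1 / sqrt \<alpha>"
  assumes "0 < \<alpha>" "0 \<le> loc_a \<alpha>"
  shows "(SUP x. \<bar>Phi_prod \<alpha> x - std_normal_cdf x\<bar>) \<in>
    {loc_a \<alpha> * \<phi> (loc_a \<alpha>) - remainder_bound h ..
     loc_a \<alpha> / sqrt (2 * pi) + (1 - scale_b \<alpha>) / scale_b \<alpha> + 2 * remainder_bound h}"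
    (is "_ \<in> {?L..?U}")
proof (rule sup_abs_bounds)
  let ?a = "loc_a \<alpha>" and ?b = "scale_b \<alpha>" and ?R = "remainder_bound h"
  have h: "0 < h" using assms by (simp add: h_def)
  have b: "0 < ?b" "?b \<le> 1" using scale_b_bounds assms by auto
  note head = Phi_prod_head[OF assms(2), folded h_def]
  have R: "Q (h / 2) \<le> ?R" "0 \<le> ?R"
  proof -
    have "Q (h / 2) \<le> \<phi> (h / 2) / (h / 2)" using h by (intro Mills_simple) auto
    moreover have "0 \<le> \<phi> (h / 2) / (h / 2)\<^sup>2 / h" "0 \<le> \<phi> (h / 2) / (h / 2)" using h by auto
    ultimately show "Q (h / 2) \<le> ?R" "0 \<le> ?R"
      unfolding remainder_bound_def by simp_all
  qed
  fix x
  have bx: "\<bar>std_normal_cdf (?b * x) - std_normal_cdf x\<bar> \<le> (1 - ?b) / ?b"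
    using b by (rule cdf_scale)
  have "Phi_prod \<alpha> x - std_normal_cdf x \<le> ?a / sqrt (2 * pi) + (1 - ?b) / ?b"
    using head(1)[of x] cdf_shift_upper[OF assms(3), of "?b * x"] bx by (simp add: add.commute)
  \<comment> \<open>Right of \<open>- h / 2\<close> the remainder bound applies, and the shift is
    harmless because it only increases the first factor. Left of it the normal distribution function
    is itself at most \<open>Q (h / 2)\<close>.\<close>
  moreover have "std_normal_cdf x - Phi_prod \<alpha> x \<le> (1 - ?b) / ?b + ?R"
  proof (cases "- h / 2 \<le> x")
    case True
    have "- h / 2 \<le> ?b * x"
    proof (cases "0 \<le> x")
      case False
      then have "x \<le> ?b * x" using b by (simp add: mult_le_cancel_right2)
      with True show ?thesis by simp
    next
      case True
      then have "0 \<le> ?b * x" using b by simp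
      with h show ?thesis by linarith
    qed
    then have "std_normal_cdf (?a + ?b * x) - ?R \<le> Phi_prod \<alpha> x"
      using assms(3) by (intro head(2)) auto
    moreover have "std_normal_cdf (?b * x) \<le> std_normal_cdf (?a + ?b * x)"
      using assms(3) by (intro std_normal_cdf_mono) auto
    ultimately show ?thesis using bx by linarith
  next
    case False
    then have "std_normal_cdf x \<le> Q (h / 2)"
      unfolding Q_minus[symmetric] by (intro Q_antimono) auto
    moreover have "0 \<le> Phi_prod \<alpha> x" by (simp add: Phi_prod_eq[OF assms(2)])
    moreover have "0 \<le> (1 - ?b) / ?b" using b by simp
    ultimately show ?thesis using R by linarith
  qed
  moreover have "0 \<le> ?a / sqrt (2 * pi)" using assms by simp
  ultimately show "\<bar>Phi_prod \<alpha> x - std_normal_cdf x\<bar> \<le> ?U" using R by linarith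
next
  have "0 < h" using assms by (simp add: h_def)
  then have "- h / 2 \<le> loc_a \<alpha> + scale_b \<alpha> * 0" using assms(3) by linarith
  from Phi_prod_head(2)[OF assms(2), folded h_def, OF this]
  show "?L \<le> \<bar>Phi_prod \<alpha> 0 - std_normal_cdf 0\<bar>"
    using cdf_shift_lower[OF assms(3)] by simp
qed

text \<open>The subtracted logarithm in \<open>loc_a\<close> vanishes at \<alpha> = 0, since
  \<open>sqrt (2 * pi) * ln (exp (1 / sqrt (2 * pi))) = 1\<close>. This gives
  \<open>loc_a \<alpha>\<close> the order \<open>sqrt \<alpha>\<close>, while the rescaling error
  and the remainder are of smaller order.\<close>

lemma small_alpha:
  "(\<lambda>\<alpha>::real. SUP x::real. \<bar>Phi_prod \<alpha> x - std_normal_cdf x\<bar>) \<sim>[at_right 0] (\<lambda>\<alpha>. sqrt \<alpha> / sqrt (2 * pi))"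
proof (rule asymp_equiv_sandwich_real)
  have pos: "eventually (\<lambda>\<alpha>::real. 0 < \<alpha>) (at_right 0)"
    by (rule eventually_at_right_less)
  have a0: "(loc_a \<longlongrightarrow> 0) (at_right 0)"
    unfolding loc_a_def by real_asymp
  have a1: "((\<lambda>\<alpha>. loc_a \<alpha> / sqrt \<alpha>) \<longlongrightarrow> 1) (at_right 0)"
    unfolding loc_a_def by real_asymp
  have b0: "((\<lambda>\<alpha>. (1 - scale_b \<alpha>) / scale_b \<alpha> / sqrt \<alpha>) \<longlongrightarrow> 0) (at_right 0)"
    unfolding scale_b_def by real_asymp
  have r0: "((\<lambda>\<alpha>. remainder_bound (1 / sqrt \<alpha>) / sqrt \<alpha>) \<longlongrightarrow> 0) (at_right 0)"
  proof -
    have "((\<lambda>h. remainder_bound h * h) \<longlongrightarrow> 0) at_top"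
      unfolding remainder_bound_def std_normal_density_def by real_asymp
    moreover have "filterlim (\<lambda>\<alpha>::real. 1 / sqrt \<alpha>) at_top (at_right 0)"
      by real_asymp
    ultimately have "((\<lambda>\<alpha>. remainder_bound (1 / sqrt \<alpha>) * (1 / sqrt \<alpha>)) \<longlongrightarrow> 0) (at_right 0)"
      by (rule filterlim_compose)
    then show ?thesis by simp
  qed
  have \<phi>0: "((\<lambda>\<alpha>. sqrt (2 * pi) * \<phi> (loc_a \<alpha>)) \<longlongrightarrow> 1) (at_right 0)"
  proof -
    have "((\<lambda>\<alpha>. exp (- (loc_a \<alpha>)\<^sup>2 / 2)) \<longlongrightarrow> exp (- 0\<^sup>2 / 2)) (at_right 0)"
      by (intro tendsto_exp tendsto_divide tendsto_minus tendsto_power a0 tendsto_const) simp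
    then show ?thesis unfolding std_normal_density_def by simp
  qed
  have "((\<lambda>\<alpha>. loc_a \<alpha> / sqrt \<alpha> * (sqrt (2 * pi) * \<phi> (loc_a \<alpha>))
      - sqrt (2 * pi) * (remainder_bound (1 / sqrt \<alpha>) / sqrt \<alpha>)) \<longlongrightarrow> 1 * 1 - sqrt (2 * pi) * 0) (at_right 0)"
    by (intro tendsto_diff tendsto_mult tendsto_const a1 \<phi>0 r0)
  then show "(\<lambda>\<alpha>. loc_a \<alpha> * \<phi> (loc_a \<alpha>) - remainder_bound (1 / sqrt \<alpha>)) \<sim>[at_right 0] (\<lambda>\<alpha>. sqrt \<alpha> / sqrt (2 * pi))"
    by (intro asymp_equivI') (simp add: diff_divide_distrib algebra_simps)
  have "((\<lambda>\<alpha>. loc_a \<alpha> / sqrt \<alpha> + sqrt (2 * pi) * ((1 - scale_b \<alpha>) / scale_b \<alpha> / sqrt \<alpha>)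
      + sqrt (2 * pi) * (2 * (remainder_bound (1 / sqrt \<alpha>) / sqrt \<alpha>)))
      \<longlongrightarrow> 1 + sqrt (2 * pi) * 0 + sqrt (2 * pi) * (2 * 0)) (at_right 0)"
    by (intro tendsto_add tendsto_mult tendsto_const a1 b0 r0)
  then have "((\<lambda>\<alpha>. (loc_a \<alpha> / sqrt (2 * pi) + (1 - scale_b \<alpha>) / scale_b \<alpha> + 2 * remainder_bound (1 / sqrt \<alpha>))
      / (sqrt \<alpha> / sqrt (2 * pi))) \<longlongrightarrow> 1) (at_right 0)"
    by (simp add: add_divide_distrib algebra_simps)
  then show "(\<lambda>\<alpha>. loc_a \<alpha> / sqrt (2 * pi) + (1 - scale_b \<alpha>) / scale_b \<alpha> + 2 * remainder_bound (1 / sqrt \<alpha>))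
      \<sim>[at_right 0] (\<lambda>\<alpha>. sqrt \<alpha> / sqrt (2 * pi))"
    by (rule asymp_equivI')
  have "eventually (\<lambda>\<alpha>. 0 < loc_a \<alpha>) (at_right 0)"
    unfolding loc_a_def by real_asymp
  then show "eventually (\<lambda>\<alpha>. (SUP x. \<bar>Phi_prod \<alpha> x - std_normal_cdf x\<bar>) \<in>
      {loc_a \<alpha> * \<phi> (loc_a \<alpha>) - remainder_bound (1 / sqrt \<alpha>) ..
       loc_a \<alpha> / sqrt (2 * pi) + (1 - scale_b \<alpha>) / scale_b \<alpha> + 2 * remainder_bound (1 / sqrt \<alpha>)}) (at_right 0)"
    using pos by eventually_elim (rule small_alpha_bounds, auto)
qed

section \<open>The Gumbel limit\<close>

text \<open>With \<open>q = M - a s\<close> the argument of \<open>\<Phi>\<close> is exactly \<open>u = s - (q - x) / s\<close>, so that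
  \<open>u\<^sup>2 = M - 2 (q - x) + (q - x)\<^sup>2 / M\<close>; the last summand is what limits the rate of convergence.\<close>

locale large_parameter =
  fixes \<alpha> M m q s :: real
  assumes \<alpha>_pos: "0 < \<alpha>"
    and M: "M = ln (\<alpha> + exp 1)" and m: "m = ln M" and s: "s = sqrt M"
    and q: "q = M - loc_a \<alpha> * s"
    and M_ge: "24 \<le> M" "6 * m \<le> M" and m_ge: "2 \<le> m"
    and q_bounds: "m \<le> q" "q \<le> m + 2"
    and scale_factor: "\<bar>q - m - ln (sqrt (2 * pi)) + 1 / 2 * ln (\<alpha> / (\<alpha> + exp 1))\<bar> \<le> 1 / M"
    and cube_le: "s ^ 3 \<le> sqrt \<alpha>"
begin

abbreviation tail_sum :: "real \<Rightarrow> real" where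
  "tail_sum x \<equiv> neg_log_tail (loc_a \<alpha> + scale_b \<alpha> * x) (1 / sqrt \<alpha>)"

lemma s_pos: "0 < s" and s_sq: "s * s = M"
  using M_ge by (auto simp: s)

text \<open>\<open>P\<close> is the main term of \<open>G u / h\<close>. Its logarithm is computed
  exactly, and the tail sum equals \<open>P\<close> up to a relative error of order
  \<open>w = 1 / u\<^sup>2\<close>, that is of order \<open>1 / M\<close>.\<close>

lemma ln_tail_sum:
  assumes "- m \<le> x" "x \<le> m"
  shows "\<bar>ln (tail_sum x) + x + (q - x)\<^sup>2 / (2 * M)\<bar> \<le> 40 * m / M" "0 < tail_sum x"
proof -
  define d where "d = q - x"
  define \<delta> where "\<delta> = d / M"
  define u where "u = s * (1 - \<delta>)"
  define P where "P = sqrt \<alpha> * (\<phi> u / u\<^sup>2)"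
  define w where "w = 1 / u\<^sup>2"
  let ?N = "tail_sum x" and ?h = "1 / sqrt \<alpha>"
  have M_pos: "0 < M" using M_ge by simp
  have h: "0 < ?h" using \<alpha>_pos by simp
  \<comment> \<open>Here \<open>q - x \<le> (m + 2) + m \<le> 3 * m\<close> because
    \<open>m \<ge> 2\<close>; then \<open>6 * m \<le> M\<close> keeps \<delta> at most 1/2, so that
    \<open>u\<close> stays comparable to \<open>s\<close>.\<close>
  have d: "0 \<le> d" "d \<le> 3 * m" using assms q_bounds m_ge by (auto simp: d_def)
  have \<delta>: "0 \<le> \<delta>" "\<delta> \<le> 3 * m / M" "\<delta> \<le> 1 / 2"
    using d M_ge M_pos by (auto simp: \<delta>_def field_simps)
  have u_eq: "loc_a \<alpha> + scale_b \<alpha> * x = u"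
  proof -
    have "scale_b \<alpha> = 1 / s" by (simp add: scale_b_def s M)
    moreover have "loc_a \<alpha> = (M - q) / s" using s_pos by (simp add: q)
    ultimately have "loc_a \<alpha> + scale_b \<alpha> * x = (M - q) / s + x / s" by simp
    also have "\<dots> = (M - d) / s" by (simp add: d_def add_divide_distrib diff_divide_distrib)
    also have "\<dots> = s * s * (1 - \<delta>) / s" using M_pos s_sq by (simp add: \<delta>_def right_diff_distrib)
    also have "\<dots> = u" using s_pos by (simp add: u_def)
    finally show ?thesis .
  qed
  have u: "0 < u" "u \<le> s"
    using s_pos \<delta> by (auto simp: u_def intro!: mult_left_le)
  have u_sq: "u\<^sup>2 = M * (1 - \<delta>)\<^sup>2"
    using s_sq by (simp add: u_def power_mult_distrib power2_eq_square)
  have "1 / 4 \<le> (1 - \<delta>)\<^sup>2"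
    using power_mono[of "1 / 2" "1 - \<delta>" 2] \<delta> by (simp add: power2_eq_square)
  then have "M * (1 / 4) \<le> u\<^sup>2" unfolding u_sq using M_pos by (intro mult_left_mono) auto
  then have w: "0 < w" "w \<le> 4 / M" using u M_pos by (auto simp: w_def field_simps)
  have "4 / M \<le> 4 / 24" using M_ge by (intro divide_left_mono) auto
  with w have w6: "w \<le> 1 / 6" by simp
  have P_pos: "0 < P" using \<alpha>_pos u by (simp add: P_def normal_density_pos)

  \<comment> \<open>The bracket is the quantity that \<open>scale_factor\<close> bounds by
    \<open>1 / M\<close>. What remains is the Gumbel exponent \<open>- x\<close>, the quadratic
    correction, and a term of order \<delta>.\<close>
  have lnP: "ln P = (q - m - ln (sqrt (2 * pi)) + 1 / 2 * ln (\<alpha> / (\<alpha> + exp 1))) - x - d\<^sup>2 / (2 * M) - 2 * ln (1 - \<delta>)"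
  proof -
    have "u\<^sup>2 / 2 = M / 2 - d + d\<^sup>2 / (2 * M)"
      unfolding u_sq \<delta>_def using M_pos by (simp add: field_simps power2_eq_square)
    then have \<phi>u: "\<phi> u = exp (- M / 2 + d - d\<^sup>2 / (2 * M)) / sqrt (2 * pi)"
      by (simp add: std_normal_density_def algebra_simps)
    have "ln P = ln (sqrt \<alpha>) + (ln (\<phi> u) - ln (u\<^sup>2))"
      unfolding P_def using \<alpha>_pos u normal_density_pos[of 1 0 u] by (simp add: ln_mult ln_div less_imp_neq)
    also have "ln (sqrt \<alpha>) = ln \<alpha> / 2" using \<alpha>_pos by (simp add: ln_sqrt)
    also have "ln (\<phi> u) = (- M / 2 + d - d\<^sup>2 / (2 * M)) - ln (sqrt (2 * pi))"
      unfolding \<phi>u by (subst ln_div) auto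
    also have "ln (u\<^sup>2) = m + 2 * ln (1 - \<delta>)"
      unfolding u_sq m using M_pos \<delta> by (simp add: ln_mult ln_realpow)
    finally have "ln P = (ln \<alpha> - M) / 2 + d - d\<^sup>2 / (2 * M) - ln (sqrt (2 * pi)) - m - 2 * ln (1 - \<delta>)"
      by (simp add: diff_divide_distrib)
    moreover have "ln (\<alpha> / (\<alpha> + exp 1)) = ln \<alpha> - M"
      unfolding M using \<alpha>_pos add_pos_pos[OF \<alpha>_pos exp_gt_zero[of 1]] by (simp add: ln_div)
    ultimately show ?thesis by (simp add: d_def)
  qed

  have lower: "P * (1 - 3 * w) \<le> ?N"
  proof -
    have "P * (1 - 3 * w) = sqrt \<alpha> * (\<phi> u / u\<^sup>2 * (1 - 3 / u\<^sup>2))" by (simp add: P_def w_def)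
    also have "\<dots> \<le> sqrt \<alpha> * G u" using \<alpha>_pos u by (intro mult_left_mono G_bounds) auto
    also have "\<dots> = G u / ?h" by simp
    also have "\<dots> \<le> ?N" unfolding u_eq by (rule neg_log_tail_ge[OF h])
    finally show ?thesis .
  qed
  have upper: "?N \<le> P * (1 + 4 * w)"
  proof -
    have "\<phi> u / u = u * \<phi> u * w" using u by (simp add: w_def power2_eq_square)
    also have "\<dots> \<le> 1 * w" using w by (intro mult_right_mono mult_std_normal_density_le_1) auto
    finally have Q1: "Q u \<le> w" using Mills_simple[OF u(1)] by simp
    \<comment> \<open>The head term \<open>Q u\<close> must be small relative to \<open>P\<close>.
      As the step is \<open>1 / sqrt \<alpha>\<close>, the bound
      \<open>u ^ 3 \<le> sqrt \<alpha>\<close> gives exactly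
      \<open>\<phi> u / u \<le> P * w\<close>.\<close>
    have "u ^ 3 \<le> sqrt \<alpha>"
      using u by (intro order_trans[OF power_mono cube_le]) auto
    then have "\<phi> u * u ^ 3 \<le> \<phi> u * sqrt \<alpha>" by (intro mult_left_mono) auto
    then have "\<phi> u * u ^ 3 / u ^ 4 \<le> \<phi> u * sqrt \<alpha> / u ^ 4"
      by (intro divide_right_mono) auto
    moreover have "\<phi> u * u ^ 3 / u ^ 4 = \<phi> u / u" using u by (simp add: eval_nat_numeral)
    moreover have "\<phi> u * sqrt \<alpha> / u ^ 4 = P * w" by (simp add: P_def w_def eval_nat_numeral mult.assoc mult.commute[of "sqrt \<alpha>"])
    ultimately have "\<phi> u / u \<le> P * w" by simp
    then have Q2: "Q u \<le> P * w" using Mills_simple[OF u(1)] by simp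
    have "sqrt \<alpha> * G u \<le> P"
      unfolding P_def using \<alpha>_pos u by (intro mult_left_mono G_bounds) auto
    then have GP: "G u / ?h + Q u \<le> P * (1 + w)" using Q2 by (simp add: algebra_simps)
    have "?N \<le> (1 + 2 * Q u) * (G u / ?h + Q u)"
      unfolding u_eq using u by (intro neg_log_tail_le h Q_le_half) auto
    also have "\<dots> \<le> (1 + 2 * Q u) * (P * (1 + w))"
      using GP Q_pos[of u] by (intro mult_left_mono) auto
    also have "\<dots> \<le> (1 + 2 * w) * (P * (1 + w))"
      using Q1 P_pos w by (intro mult_right_mono) auto
    also have "\<dots> = P * (1 + 3 * w + 2 * w * w)" by (simp add: algebra_simps)
    also have "\<dots> \<le> P * (1 + 4 * w)"
      using P_pos w w6 by (intro mult_left_mono) auto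
    finally show ?thesis .
  qed
  have "0 < P * (1 - 3 * w)" using P_pos w6 by simp
  with lower show N_pos: "0 < ?N" by simp

  have lnN: "\<bar>ln ?N - ln P\<bar> \<le> 24 / M"
  proof -
    have "ln ?N \<le> ln (P * (1 + 4 * w))" using upper N_pos P_pos w by (subst ln_le_cancel_iff) auto
    also have "\<dots> = ln P + ln (1 + 4 * w)" using P_pos w by (simp add: ln_mult)
    also have "ln (1 + 4 * w) \<le> 4 * w" using w by (intro ln_add_one_self_le_self) auto
    finally have 1: "ln ?N \<le> ln P + 4 * w" by simp
    have "- (3 * w) - 2 * (3 * w)\<^sup>2 \<le> ln (1 - 3 * w)"
      using w w6 by (intro ln_one_minus_pos_lower_bound) auto
    moreover have "w * w \<le> w * (1 / 6)" using w w6 by (intro mult_left_mono) auto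
    ultimately have "- 6 * w \<le> ln (1 - 3 * w)" by (simp add: power2_eq_square)
    also have "ln P + ln (1 - 3 * w) = ln (P * (1 - 3 * w))"
      using P_pos w6 by (simp add: ln_mult)
    then have "ln P + ln (1 - 3 * w) \<le> ln ?N"
      using lower N_pos P_pos w6 by (simp del: ln_mult)
    ultimately have "ln P - 6 * w \<le> ln ?N" by linarith
    with 1 w have "\<bar>ln ?N - ln P\<bar> \<le> 6 * w" by auto
    also have "\<dots> \<le> 24 / M" using w by simp
    finally show ?thesis .
  qed
  have ln\<delta>: "0 \<le> - 2 * ln (1 - \<delta>)" "- 2 * ln (1 - \<delta>) \<le> 12 * m / M"
  proof -
    show "0 \<le> - 2 * ln (1 - \<delta>)" using \<delta> by simp
    have "- \<delta> - 2 * \<delta>\<^sup>2 \<le> ln (1 - \<delta>)" using \<delta> by (intro ln_one_minus_pos_lower_bound) auto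
    moreover have "\<delta> * \<delta> \<le> \<delta> * (1 / 2)" using \<delta> by (intro mult_left_mono) auto
    ultimately have "- 2 * ln (1 - \<delta>) \<le> 4 * \<delta>" by (simp add: power2_eq_square)
    with \<delta>(2) show "- 2 * ln (1 - \<delta>) \<le> 12 * m / M" by simp
  qed
  have "\<bar>ln ?N + x + d\<^sup>2 / (2 * M)\<bar> \<le> 1 / M + 12 * m / M + 24 / M"
    using scale_factor lnN ln\<delta> lnP by linarith
  \<comment> \<open>The 25 collects 1 from \<open>scale_factor\<close> and 24 from the comparison
    with \<open>P\<close>; it is at most \<open>28 * m\<close>.\<close>
  also have "\<dots> = (12 * m + 25) / M" by (simp add: add_divide_distrib)
  also have "\<dots> \<le> 40 * m / M" using m_ge M_pos by (intro divide_right_mono) auto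
  finally show "\<bar>ln ?N + x + (q - x)\<^sup>2 / (2 * M)\<bar> \<le> 40 * m / M" by (simp only: d_def)
qed

end

section \<open>Elementary inequalities for the double exponential\<close>

lemma abs_exp_minus_1_le: "\<bar>exp t - 1\<bar> \<le> \<bar>t\<bar> * exp \<bar>t\<bar>" for t :: real
proof (cases "0 \<le> t")
  case True
  have "exp t * (1 - t) \<le> exp t * exp (- t)"
    using exp_ge_add_one_self[of "- t"] by (intro mult_left_mono) auto
  then have "exp t - 1 \<le> t * exp t" by (simp add: exp_minus algebra_simps)
  with True show ?thesis by simp
next
  case False
  then have "exp t \<le> 1" by simp
  then have "\<bar>exp t - 1\<bar> \<le> \<bar>t\<bar> * 1" using exp_ge_add_one_self[of t] by linarith
  also have "\<dots> \<le> \<bar>t\<bar> * exp \<bar>t\<bar>" by (intro mult_left_mono) auto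
  finally show ?thesis .
qed

text \<open>Factoring out \<open>exp (- y)\<close> leaves \<open>exp t - 1\<close> with
  \<open>t = y * (1 - exp (- \<eta>))\<close>. Using the estimate for \<open>exp t - 1\<close> at
  both levels keeps the weight \<open>y * exp (- y)\<close>, on which the sharp constant
  depends.\<close>

lemma double_exp_perturbation:
  fixes y \<eta> E \<tau> :: real
  assumes "0 < y" "\<bar>\<eta>\<bar> \<le> E" "y * E * exp E \<le> \<tau>"
  shows "\<bar>exp (- (y * exp (- \<eta>))) - exp (- y)\<bar> \<le> y * exp (- y) * \<bar>\<eta>\<bar> * exp (\<tau> + E)"
proof -
  let ?t = "y - y * exp (- \<eta>)"
  have "?t = - (y * (exp (- \<eta>) - 1))" by (simp add: right_diff_distrib)
  then have "\<bar>?t\<bar> = y * \<bar>exp (- \<eta>) - 1\<bar>" using assms(1) by (simp only: abs_minus_cancel abs_mult abs_of_pos)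
  also have "\<dots> \<le> y * (\<bar>\<eta>\<bar> * exp E)"
    using assms abs_exp_minus_1_le[of "- \<eta>"]
    by (intro mult_left_mono order_trans[OF abs_exp_minus_1_le]) (auto intro!: mult_left_mono)
  finally have t: "\<bar>?t\<bar> \<le> y * (\<bar>\<eta>\<bar> * exp E)" .
  also have "\<dots> \<le> y * (E * exp E)" using assms by (intro mult_left_mono mult_right_mono) auto
  finally have t\<tau>: "\<bar>?t\<bar> \<le> \<tau>" using assms(3) by (simp add: mult.assoc)
  have "\<bar>exp ?t - 1\<bar> \<le> \<bar>?t\<bar> * exp \<bar>?t\<bar>" by (rule abs_exp_minus_1_le)
  also have "\<dots> \<le> (y * (\<bar>\<eta>\<bar> * exp E)) * exp \<tau>"
    using t t\<tau> assms by (intro mult_mono) auto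
  finally have "exp (- y) * \<bar>exp ?t - 1\<bar> \<le> exp (- y) * (y * (\<bar>\<eta>\<bar> * exp E) * exp \<tau>)"
    by (intro mult_left_mono) auto
  moreover have "exp (- (y * exp (- \<eta>))) - exp (- y) = exp (- y) * (exp ?t - 1)"
    by (simp add: right_diff_distrib flip: exp_add)
  ultimately show ?thesis by (simp add: abs_mult exp_add mult_ac)
qed

lemma mult_exp_minus_le: "y * exp (- y) \<le> 1 / exp 1" for y :: real
proof -
  have "y \<le> exp (y - 1)" using exp_ge_add_one_self[of "y - 1"] by simp
  then have "y * exp (- y) \<le> exp (y - 1) * exp (- y)" by (intro mult_right_mono) auto
  also have "\<dots> = exp (- 1)" by (simp flip: exp_add)
  also have "\<dots> = 1 / exp 1" by (simp add: exp_minus divide_inverse)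
  finally show ?thesis .
qed

lemma power_le_exp:
  fixes y :: real
  assumes "0 \<le> y" "0 < n"
  shows "y ^ n \<le> real n ^ n * exp y"
proof -
  have "(y / real n) ^ n \<le> (1 + y / real n) ^ n"
    using assms by (intro power_mono) auto
  also have "\<dots> \<le> exp y" using assms by (intro exp_ge_one_plus_x_over_n_power_n) auto
  finally show ?thesis using assms by (simp add: power_divide divide_simps mult.commute)
qed

text \<open>For \<open>y \<ge> 1\<close> use \<open>ln y \<le> y\<close> and
  \<open>y ^ 3 \<le> 27 * exp y\<close>; for \<open>y < 1\<close> the substitution
  \<open>y = exp (- t)\<close> reduces to \<open>t\<^sup>2 \<le> 4 * exp t\<close>.\<close>

lemma mult_exp_minus_ln_sq_le:
  fixes y :: real
  assumes "0 < y"
  shows "y * exp (- y) * (ln y)\<^sup>2 \<le> 27"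
proof (cases "1 \<le> y")
  case True
  then have "0 \<le> ln y" "ln y \<le> y" using ln_le_minus_one[of y] by auto
  then have "y * exp (- y) * (ln y)\<^sup>2 \<le> y * exp (- y) * y\<^sup>2"
    using assms by (intro mult_left_mono power_mono) auto
  also have "\<dots> = y ^ 3 * exp (- y)" by (simp add: power3_eq_cube power2_eq_square)
  also have "\<dots> \<le> (real 3 ^ 3 * exp y) * exp (- y)"
    using assms by (intro mult_right_mono power_le_exp) auto
  also have "\<dots> = 27" by (simp add: exp_minus)
  finally show ?thesis .
next
  case False
  define t where "t = - ln y"
  have t: "0 \<le> t" "y = exp (- t)" "ln y = - t" using False assms by (auto simp: t_def)
  have "y * exp (- y) * (ln y)\<^sup>2 \<le> y * 1 * (ln y)\<^sup>2"
    using assms by (intro mult_right_mono mult_left_mono) auto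
  also have "\<dots> = t\<^sup>2 * exp (- t)" unfolding t(3) by (simp add: t(2))
  also have "\<dots> \<le> (real 2 ^ 2 * exp t) * exp (- t)"
    using t by (intro mult_right_mono power_le_exp) auto
  also have "\<dots> = 4" by (simp add: exp_minus)
  finally show ?thesis by simp
qed

text \<open>Only the coefficient of \<open>q\<^sup>2\<close> must be sharp, and it is the maximum
  \<open>1 / exp 1\<close> of \<open>y * exp (- y)\<close>. The cross term is made linear in
  \<open>q\<close> by \<open>2 * ln y \<le> 1 + (ln y)\<^sup>2\<close>, whence 28 = 1 + 27.\<close>

lemma weighted_square_le:
  fixes y q :: real
  assumes "0 < y" "0 \<le> q"
  shows "y * exp (- y) * (q + ln y)\<^sup>2 \<le> q\<^sup>2 / exp 1 + 28 * q + 27"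
proof -
  define k where "k = y * exp (- y)"
  have k: "0 \<le> k" "k \<le> 1 / exp 1" using assms mult_exp_minus_le[of y] by (auto simp: k_def)
  have k1: "k \<le> 1" by (rule order_trans[OF k(2)]) simp
  have k2: "k * (ln y)\<^sup>2 \<le> 27" unfolding k_def by (rule mult_exp_minus_ln_sq_le[OF assms(1)])
  have "0 \<le> (ln y - 1)\<^sup>2" by simp
  then have "2 * ln y \<le> 1 + (ln y)\<^sup>2" by (simp add: power2_eq_square algebra_simps)
  then have "k * (2 * ln y) \<le> k * (1 + (ln y)\<^sup>2)" using k by (intro mult_left_mono)
  then have "k * (2 * ln y) \<le> 28" using k1 k2 by (simp add: distrib_left)
  then have "q * (k * (2 * ln y)) \<le> q * 28" using assms by (intro mult_left_mono)
  moreover have "k * q\<^sup>2 \<le> 1 / exp 1 * q\<^sup>2" using k by (intro mult_right_mono) auto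
  moreover have "k * (q + ln y)\<^sup>2 = k * q\<^sup>2 + q * (k * (2 * ln y)) + k * (ln y)\<^sup>2"
    by (simp add: power2_eq_square algebra_simps)
  moreover have "1 / exp 1 * q\<^sup>2 = q\<^sup>2 / exp 1" by simp
  ultimately show ?thesis using k2 unfolding k_def[symmetric] by linarith
qed

text \<open>\<eta> is a lower bound for the exponent at \<open>x = 0\<close>; the quotient
  \<open>\<eta> / (1 + \<eta>)\<close> is a rational lower bound for
  \<open>1 - exp (- \<eta>)\<close>.\<close>

definition gumbel_lower :: "real \<Rightarrow> real" where
  "gumbel_lower M = (let \<eta> = (ln M)\<^sup>2 / (2 * M) - 40 * ln M / M in \<eta> / (1 + \<eta>) / exp 1)"

text \<open>\<open>E\<close> bounds the perturbation \<eta>, and \<open>4 * ln M\<close> bounds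
  \<open>exp (- x)\<close> on the range where the perturbation estimate is applied. The final factor
  tends to 1.\<close>

definition gumbel_upper :: "real \<Rightarrow> real" where
  "gumbel_upper M = (let E = 50 * (ln M)\<^sup>2 / M in
     ((ln M + 2)\<^sup>2 / (2 * exp 1 * M) + (28 * (ln M + 2) + 27) / (2 * M) + 40 * ln M / M)
       * exp (4 * ln M * E * exp E + E))"

section \<open>Comparison with the Gumbel law at a fixed parameter\<close>

context large_parameter
begin

lemma Phi_prod_tail_sum: "Phi_prod \<alpha> x = exp (- tail_sum x)"
  by (rule Phi_prod_eq[OF \<alpha>_pos])

lemma tail_sum_antimono: "x \<le> x' \<Longrightarrow> tail_sum x' \<le> tail_sum x"
  using \<alpha>_pos scale_b_bounds(1)[OF \<alpha>_pos] by (intro neg_log_tail_antimono) auto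

text \<open>Recasts the logarithmic estimate as a multiplicative perturbation of
  \<open>exp (- x)\<close>. The crude bound on \<eta> uses \<open>q - x \<le> 3 * m\<close> and
  \<open>9 / 2 + 40 \<le> 50\<close>.\<close>

lemma tail_sum_eq:
  assumes "- m \<le> x" "x \<le> m"
  obtains \<eta> where "tail_sum x = exp (- x) * exp (- \<eta>)"
    "\<bar>\<eta> - (q - x)\<^sup>2 / (2 * M)\<bar> \<le> 40 * m / M" "\<bar>\<eta>\<bar> \<le> 50 * m\<^sup>2 / M"
proof -
  define \<eta> where "\<eta> = - x - ln (tail_sum x)"
  have M_pos: "0 < M" using M_ge by simp
  note * = ln_tail_sum[OF assms]
  have "exp (- x) * exp (- \<eta>) = exp (ln (tail_sum x))" by (simp add: \<eta>_def flip: exp_add)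
  then have 1: "tail_sum x = exp (- x) * exp (- \<eta>)" using * by simp
  have 2: "\<bar>\<eta> - (q - x)\<^sup>2 / (2 * M)\<bar> \<le> 40 * m / M" using *(1) by (simp add: \<eta>_def)
  have "(q - x)\<^sup>2 \<le> (3 * m)\<^sup>2" using assms q_bounds m_ge by (intro power_mono) auto
  then have "(q - x)\<^sup>2 / (2 * M) \<le> (3 * m)\<^sup>2 / (2 * M)" using M_pos by (intro divide_right_mono) auto
  moreover have "0 \<le> (q - x)\<^sup>2 / (2 * M)" using M_pos by simp
  ultimately have "\<bar>\<eta>\<bar> \<le> (3 * m)\<^sup>2 / (2 * M) + 40 * m / M" using 2 by linarith
  also have "\<dots> = (9 / 2 * m\<^sup>2 + 40 * m) / M"
    using M_pos by (simp add: field_simps power2_eq_square)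
  also have "\<dots> \<le> 50 * m\<^sup>2 / M"
  proof (intro divide_right_mono)
    have "1 * m \<le> m * m" "0 \<le> m * m" using m_ge by (auto intro: mult_right_mono)
    then show "9 / 2 * m\<^sup>2 + 40 * m \<le> 50 * m\<^sup>2" unfolding power2_eq_square by linarith
  qed (use M_pos in auto)
  finally show ?thesis using that 1 2 by blast
qed

text \<open>At \<open>x = 0\<close> the weight \<open>exp (- x) * exp (- exp (- x))\<close> attains its maximum \<open>1 / e\<close>.\<close>

lemma gumbel_bound_lower:
  assumes "40 * m / M \<le> m\<^sup>2 / (2 * M)"
  shows "gumbel_lower M \<le> \<bar>Phi_prod \<alpha> 0 - exp (- exp (- 0))\<bar>"
proof -
  have M_pos: "0 < M" using M_ge by simp
  obtain \<eta> where \<eta>: "tail_sum 0 = exp (- 0) * exp (- \<eta>)" "\<bar>\<eta> - (q - 0)\<^sup>2 / (2 * M)\<bar> \<le> 40 * m / M"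
    using tail_sum_eq[of 0] m_ge by auto
  define \<eta>0 where "\<eta>0 = m\<^sup>2 / (2 * M) - 40 * m / M"
  have \<eta>0: "0 \<le> \<eta>0" using assms by (simp add: \<eta>0_def)
  have "m\<^sup>2 / (2 * M) \<le> q\<^sup>2 / (2 * M)"
    using M_pos q_bounds m_ge by (intro divide_right_mono power_mono) auto
  with \<eta>(2) have "\<eta>0 \<le> \<eta>" unfolding \<eta>0_def by simp
  have "exp (- \<eta>) \<le> exp (- \<eta>0)" using \<open>\<eta>0 \<le> \<eta>\<close> by simp
  also have "\<dots> \<le> 1 / (1 + \<eta>0)"
    unfolding exp_minus inverse_eq_divide
    using \<eta>0 exp_ge_add_one_self[of \<eta>0] by (intro divide_left_mono) (auto intro!: mult_pos_pos add_pos_nonneg)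
  also have "\<dots> = 1 - \<eta>0 / (1 + \<eta>0)" using \<eta>0 by (simp add: field_simps)
  finally have "\<eta>0 / (1 + \<eta>0) \<le> 1 - tail_sum 0" using \<eta>(1) by simp
  \<comment> \<open>Dividing by \<open>exp 1\<close> turns the right side into
    \<open>exp (- tail_sum 0) - exp (- 1)\<close>, the difference of the two laws at 0.\<close>
  also have "\<dots> \<le> exp (1 - tail_sum 0) - 1" using exp_ge_add_one_self[of "1 - tail_sum 0"] by simp
  finally have "\<eta>0 / (1 + \<eta>0) / exp 1 \<le> (exp (1 - tail_sum 0) - 1) / exp 1"
    by (rule divide_right_mono) simp
  also have "\<dots> = Phi_prod \<alpha> 0 - exp (- exp (- 0))"
    unfolding Phi_prod_tail_sum by (simp add: exp_diff exp_minus field_simps)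
  finally show ?thesis
    unfolding gumbel_lower_def Let_def \<eta>0_def m by linarith
qed

text \<open>In the middle range the perturbation estimate applies. On the far left both functions
  are at most \<open>1 / M\<close>, on the far right both are within \<open>2 / M\<close> of 1, and
  \<open>2 / M\<close> is below the main bound.\<close>

lemma gumbel_bound_upper:
  assumes E2: "exp (50 * m\<^sup>2 / M) \<le> 2" and ln4: "ln (4 * m) \<le> m" and U: "2 / M \<le> gumbel_upper M"
  shows "\<bar>Phi_prod \<alpha> x - exp (- exp (- x))\<bar> \<le> gumbel_upper M"
proof -
  define E where "E = 50 * m\<^sup>2 / M"
  have M_pos: "0 < M" using M_ge by simp
  have E: "0 \<le> E" "exp E \<le> 2" using M_pos E2 by (auto simp: E_def)
  have m4: "0 \<le> ln (4 * m)" using m_ge by simp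
  have expm: "exp (- m) = 1 / M" using M_pos by (simp add: m exp_minus divide_inverse)
  \<comment> \<open>The left cut is where \<open>exp (- x) = 4 * m\<close>. This is small enough for
    \<open>y * E\<close> to be of order \<open>m ^ 3 / M\<close>, and large enough for the tail sum
    to be at least \<open>m\<close> there, even after losing a factor 2, so that
    \<open>exp (- m) = 1 / M\<close> bounds the product.\<close>
  consider "x < - ln (4 * m)" | "- ln (4 * m) \<le> x" "x \<le> m" | "m < x" by linarith
  then show ?thesis
  proof cases
    case 1
    let ?x = "- ln (4 * m)"
    have "- m \<le> ?x" "?x \<le> m" using ln4 m4 m_ge by linarith+
    then obtain \<eta> where \<eta>: "tail_sum ?x = exp (- ?x) * exp (- \<eta>)" "\<bar>\<eta>\<bar> \<le> E"
      using tail_sum_eq[of ?x] unfolding E_def by blast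
    have "exp (- \<eta>) \<ge> exp (- E)" using \<eta>(2) by simp
    moreover have "exp (- E) \<ge> 1 / 2" using E by (simp add: exp_minus field_simps)
    ultimately have "1 / 2 \<le> exp (- \<eta>)" by linarith
    then have "4 * m * (1 / 2) \<le> 4 * m * exp (- \<eta>)" using m_ge by (intro mult_left_mono) auto
    also have "\<dots> = tail_sum ?x" using \<eta>(1) m_ge by simp
    also have "\<dots> \<le> tail_sum x" using 1 by (intro tail_sum_antimono) auto
    finally have "m \<le> tail_sum x" using m_ge by simp
    then have "Phi_prod \<alpha> x \<le> 1 / M" unfolding Phi_prod_tail_sum expm[symmetric] by simp
    moreover have "0 \<le> Phi_prod \<alpha> x" by (simp add: Phi_prod_tail_sum)
    moreover have "exp (ln (4 * m)) \<le> exp (- x)" using 1 by simp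
    then have "m \<le> exp (- x)" using m_ge by simp
    then have "exp (- exp (- x)) \<le> 1 / M" unfolding expm[symmetric] by simp
    moreover have "0 \<le> exp (- exp (- x))" by simp
    moreover have "1 / M \<le> 2 / M" using M_pos by (simp add: divide_right_mono)
    ultimately show ?thesis using U by linarith
  next
    case 2
    define y where "y = exp (- x)"
    have "x \<ge> - m" using 2 ln4 by simp
    then obtain \<eta> where \<eta>: "tail_sum x = y * exp (- \<eta>)"
      "\<bar>\<eta> - (q - x)\<^sup>2 / (2 * M)\<bar> \<le> 40 * m / M" "\<bar>\<eta>\<bar> \<le> E"
      using tail_sum_eq[of x] 2 unfolding E_def y_def by blast
    have y: "0 < y" "ln y = - x" by (auto simp: y_def)
    have "y \<le> exp (ln (4 * m))" unfolding y_def exp_le_cancel_iff using 2 by simp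
    then have y4: "y \<le> 4 * m" using m_ge by simp
    have "y * E * exp E \<le> 4 * m * E * exp E"
      using y4 E by (intro mult_right_mono) auto
    from double_exp_perturbation[OF y(1) \<eta>(3) this]
    have "\<bar>Phi_prod \<alpha> x - exp (- exp (- x))\<bar> \<le> y * exp (- y) * \<bar>\<eta>\<bar> * exp (4 * m * E * exp E + E)"
      unfolding Phi_prod_tail_sum \<eta>(1) by (simp add: y_def)
    also have "\<dots> \<le> ((m + 2)\<^sup>2 / (2 * exp 1 * M) + (28 * (m + 2) + 27) / (2 * M) + 40 * m / M)
        * exp (4 * m * E * exp E + E)"
    proof (rule mult_right_mono)
      define k where "k = y * exp (- y)"
      have k: "0 \<le> k" "k \<le> 1"
        using y order_trans[OF mult_exp_minus_le[of y], of 1] by (auto simp: k_def)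
      have "0 \<le> (q - x)\<^sup>2 / (2 * M)" using M_pos by simp
      then have "\<bar>\<eta>\<bar> \<le> (q - x)\<^sup>2 / (2 * M) + 40 * m / M" using \<eta>(2) by linarith
      then have "k * \<bar>\<eta>\<bar> \<le> k * ((q - x)\<^sup>2 / (2 * M) + 40 * m / M)"
        using k by (intro mult_left_mono)
      also have "\<dots> = k * (q + ln y)\<^sup>2 / (2 * M) + k * (40 * m / M)"
        by (simp add: y distrib_left)
      \<comment> \<open>This term is of lower order than \<open>m\<^sup>2 / M\<close>, so the weight
        may be bounded by 1; the quadratic term keeps the sharp weight.\<close>
      also have "k * (40 * m / M) \<le> 1 * (40 * m / M)"
        using k M_pos m_ge by (intro mult_right_mono) auto
      also have "k * (q + ln y)\<^sup>2 / (2 * M) \<le> (q\<^sup>2 / exp 1 + 28 * q + 27) / (2 * M)"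
        unfolding k_def using M_pos y q_bounds m_ge by (intro divide_right_mono weighted_square_le) auto
      also have "\<dots> \<le> ((m + 2)\<^sup>2 / exp 1 + 28 * (m + 2) + 27) / (2 * M)"
        using M_pos q_bounds m_ge by (intro divide_right_mono add_mono power_mono mult_left_mono) auto
      also have "\<dots> = (m + 2)\<^sup>2 / (2 * exp 1 * M) + (28 * (m + 2) + 27) / (2 * M)"
        by (simp add: add_divide_distrib mult_ac)
      finally show "y * exp (- y) * \<bar>\<eta>\<bar> \<le> (m + 2)\<^sup>2 / (2 * exp 1 * M) + (28 * (m + 2) + 27) / (2 * M) + 40 * m / M"
        by (simp add: k_def)
    qed simp
    also have "\<dots> = gumbel_upper M" by (simp only: gumbel_upper_def Let_def E_def m)
    finally show ?thesis .
  next
    case 3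
    obtain \<eta> where \<eta>: "tail_sum m = exp (- m) * exp (- \<eta>)" "\<bar>\<eta>\<bar> \<le> E"
      using tail_sum_eq[of m] m_ge unfolding E_def by auto
    have "exp (- \<eta>) \<le> exp E" using \<eta>(2) by simp
    then have "exp (- \<eta>) \<le> 2" using E by linarith
    then have "1 / M * exp (- \<eta>) \<le> 1 / M * 2" using M_pos by (intro mult_left_mono) auto
    then have "tail_sum m \<le> 2 / M" unfolding \<eta>(1) expm by simp
    then have S: "tail_sum x \<le> 2 / M" using tail_sum_antimono[of m x] 3 by simp
    have S0: "0 \<le> tail_sum x" using \<alpha>_pos by (intro neg_log_tail_nonneg) auto
    have "exp (- x) \<le> exp (- m)" using 3 by simp
    also have "\<dots> \<le> 2 / M" unfolding expm using M_pos by (intro divide_right_mono) auto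
    finally have y: "exp (- x) \<le> 2 / M" .
    have "1 - 2 / M \<le> Phi_prod \<alpha> x" "Phi_prod \<alpha> x \<le> 1"
      using S S0 exp_ge_add_one_self[of "- tail_sum x"] by (auto simp: Phi_prod_tail_sum)
    moreover have "1 - 2 / M \<le> exp (- exp (- x))" "exp (- exp (- x)) \<le> 1"
      using y exp_ge_add_one_self[of "- exp (- x)"] by auto
    ultimately show ?thesis using U by linarith
  qed
qed

end

section \<open>Passage to the limit of large \<alpha>\<close>

lemma large_alpha:
  "(\<lambda>\<alpha>::real. SUP x::real. \<bar>Phi_prod \<alpha> x - exp (- exp (- x))\<bar>) \<sim>[at_top]
     (\<lambda>\<alpha>. (ln (ln \<alpha>))\<^sup>2 / (2 * exp 1 * ln \<alpha>))"
proof -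
  let ?M = "\<lambda>\<alpha>::real. ln (\<alpha> + exp 1)"
  let ?S = "\<lambda>\<alpha>::real. SUP x::real. \<bar>Phi_prod \<alpha> x - exp (- exp (- x))\<bar>"
  have M: "filterlim ?M at_top at_top" by real_asymp
  \<comment> \<open>Conditions on \<open>M\<close> alone are proved for large \<open>M\<close> and
    pulled back along \<open>M = ln (\<alpha> + exp 1)\<close>.\<close>
  note ev = eventually_compose_filterlim[OF _ M]
  have c1: "eventually (\<lambda>M::real. 24 \<le> M \<and> 6 * ln M \<le> M \<and> 2 \<le> ln M) at_top"
    by (intro eventually_conj; real_asymp)
  have c2: "eventually (\<lambda>M::real. 40 * ln M / M \<le> (ln M)\<^sup>2 / (2 * M)) at_top" by real_asymp
  have c3: "eventually (\<lambda>M::real. exp (50 * (ln M)\<^sup>2 / M) \<le> 2) at_top" by real_asymp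
  have c4: "eventually (\<lambda>M::real. ln (4 * ln M) \<le> ln M) at_top" by real_asymp
  have c5: "eventually (\<lambda>M::real. 2 / M \<le> gumbel_upper M) at_top"
    unfolding gumbel_upper_def Let_def by real_asymp
  define q where "q \<alpha> = ?M \<alpha> - loc_a \<alpha> * sqrt (?M \<alpha>)" for \<alpha>
  have q3: "eventually (\<lambda>\<alpha>. \<bar>q \<alpha> - ln (?M \<alpha>) - ln (sqrt (2 * pi)) + 1 / 2 * ln (\<alpha> / (\<alpha> + exp 1))\<bar> \<le> 1 / ?M \<alpha>) at_top"
  proof -
    have "((\<lambda>\<alpha>. (q \<alpha> - ln (?M \<alpha>) - ln (sqrt (2 * pi)) + 1 / 2 * ln (\<alpha> / (\<alpha> + exp 1))) * ?M \<alpha>) \<longlongrightarrow> 0) at_top"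
      unfolding q_def loc_a_def by real_asymp
    then have "eventually (\<lambda>\<alpha>. \<bar>(q \<alpha> - ln (?M \<alpha>) - ln (sqrt (2 * pi)) + 1 / 2 * ln (\<alpha> / (\<alpha> + exp 1))) * ?M \<alpha>\<bar> < 1) at_top"
      by (auto dest: tendstoD[where e = 1])
    then show ?thesis
      using ev[OF c1]
    proof eventually_elim
      case (elim \<alpha>)
      then have "0 < ?M \<alpha>" by linarith
      with elim(1) show ?case
        by (simp only: abs_mult abs_of_pos pos_le_divide_eq less_imp_le)
    qed
  qed
  \<comment> \<open>These numerical bounds place \<open>q\<close> between \<open>m\<close> and
    \<open>m + 2\<close>: from below 1/2 exceeds the error 1/24, from above 46/25 + 1/10 + 1/24 is
    less than 2.\<close>
  have ln_const: "1 / 2 \<le> ln (sqrt (2 * pi))" "ln (sqrt (2 * pi)) \<le> 46 / 25"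
  proof -
    have "sqrt (2 * pi) \<le> 71 / 25"
      by (rule real_le_lsqrt) (use pi_less_4 in \<open>auto simp: power2_eq_square\<close>)
    moreover have "ln (sqrt (2 * pi)) \<le> sqrt (2 * pi) - 1" by (rule ln_le_minus_one) simp
    ultimately show "ln (sqrt (2 * pi)) \<le> 46 / 25" by simp
    have "2 \<le> sqrt (2 * pi)"
      by (rule real_le_rsqrt) (use pi_gt3 in \<open>auto simp: power2_eq_square\<close>)
    then have "1 / sqrt (2 * pi) \<le> 1 / 2" by (intro divide_left_mono) auto
    moreover have "ln (1 / sqrt (2 * pi)) \<le> 1 / sqrt (2 * pi) - 1" by (rule ln_le_minus_one) simp
    moreover have "ln (1 / sqrt (2 * pi)) = - ln (sqrt (2 * pi))" by (simp add: ln_div)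
    ultimately show "1 / 2 \<le> ln (sqrt (2 * pi))" by linarith
  qed
  have "eventually (\<lambda>\<alpha>::real. - (1 / 10) \<le> 1 / 2 * ln (\<alpha> / (\<alpha> + exp 1)) \<and> 1 / 2 * ln (\<alpha> / (\<alpha> + exp 1)) \<le> 0) at_top"
    by (intro eventually_conj; real_asymp)
  with q3 ev[OF c1] have q12: "eventually (\<lambda>\<alpha>. ln (?M \<alpha>) \<le> q \<alpha> \<and> q \<alpha> \<le> ln (?M \<alpha>) + 2) at_top"
  proof eventually_elim
    case (elim \<alpha>)
    then have "1 / ?M \<alpha> \<le> 1 / 24" by (intro divide_left_mono) auto
    with elim(1) conjunct1[OF elim(3)] conjunct2[OF elim(3)] ln_const
    have "ln (?M \<alpha>) \<le> q \<alpha>" "q \<alpha> \<le> ln (?M \<alpha>) + 2" by linarith+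
    then show ?case by simp
  qed
  have q4: "eventually (\<lambda>\<alpha>. sqrt (?M \<alpha>) ^ 3 \<le> sqrt \<alpha>) at_top" by real_asymp
  have lim: "(\<lambda>\<alpha>. (ln (?M \<alpha>))\<^sup>2 / (2 * exp 1 * ?M \<alpha>)) \<sim>[at_top] (\<lambda>\<alpha>. (ln (ln \<alpha>))\<^sup>2 / (2 * exp 1 * ln \<alpha>))"
    by real_asymp
  have L: "gumbel_lower \<sim>[at_top] (\<lambda>M. (ln M)\<^sup>2 / (2 * exp 1 * M))"
    unfolding gumbel_lower_def Let_def by real_asymp
  have U: "gumbel_upper \<sim>[at_top] (\<lambda>M. (ln M)\<^sup>2 / (2 * exp 1 * M))"
    unfolding gumbel_upper_def Let_def by real_asymp
  show ?thesis
  proof (rule asymp_equiv_sandwich_real)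
    show "(\<lambda>\<alpha>. gumbel_lower (?M \<alpha>)) \<sim>[at_top] (\<lambda>\<alpha>. (ln (ln \<alpha>))\<^sup>2 / (2 * exp 1 * ln \<alpha>))"
      by (rule asymp_equiv_trans[OF asymp_equiv_compose'[OF L M] lim])
    show "(\<lambda>\<alpha>. gumbel_upper (?M \<alpha>)) \<sim>[at_top] (\<lambda>\<alpha>. (ln (ln \<alpha>))\<^sup>2 / (2 * exp 1 * ln \<alpha>))"
      by (rule asymp_equiv_trans[OF asymp_equiv_compose'[OF U M] lim])
    show "eventually (\<lambda>\<alpha>. ?S \<alpha> \<in> {gumbel_lower (?M \<alpha>)..gumbel_upper (?M \<alpha>)}) at_top"
      using eventually_gt_at_top[of 0] ev[OF c1] ev[OF c2] ev[OF c3] ev[OF c4] ev[OF c5] q12 q3 q4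
    proof eventually_elim
      case (elim \<alpha>)
      interpret large_parameter \<alpha> "?M \<alpha>" "ln (?M \<alpha>)" "q \<alpha>" "sqrt (?M \<alpha>)"
        using elim by unfold_locales (auto simp: q_def)
      show ?case
        using elim by (intro sup_abs_bounds[where y = 0] gumbel_bound_lower gumbel_bound_upper) auto
    qed
  qed
qed

theorem mainTheorem2:
  shows "((\<lambda>\<alpha>::real. SUP x::real. \<bar>Phi_prod \<alpha> x - std_normal_cdf x\<bar>)
            \<sim>[at_right 0] (\<lambda>\<alpha>. sqrt \<alpha> / sqrt (2 * pi)))
       \<and> ((\<lambda>\<alpha>::real. SUP x::real. \<bar>Phi_prod \<alpha> x - exp (- exp (- x))\<bar>)
            \<sim>[at_top] (\<lambda>\<alpha>. (ln (ln \<alpha>))\<^sup>2 / (2 * exp 1 * ln \<alpha>)))"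
  using small_alpha large_alpha by (rule conjI)

end
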